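(* For $n\ge 0$ we have $$A_n(x,y,t\,|\,\alpha)=\sum_{j=0}^{\lfloor n/2\rfloor}\gamma_{n,j}(\alpha,t)(xy)^j(x+y)^{n-2j},$$ where, for each $0\le j\le\lfloor n/2\rfloor$, $\gamma_{n,j}(\alpha,t)$ is given by each of the following six (equal) expressions: $$\gamma_{n,j}(\alpha,t)=\sum_{\substack{\sigma\in\mathfrak{S}_{n+1}\\ \mathrm{da}(\sigma)=0,\ \mathrm{asc}(\sigma)=j}}\alpha^{\mathrm{lmax}(\sigma)+\mathrm{rmax}(\sigma)-2}t^{\mathrm{rmaxdd}(\sigma)}=\sum_{\substack{\sigma\in\mathfrak{S}_n\\ \mathrm{cda}(\sigma)=0,\ \mathrm{exc}(\sigma)=j}}2^{\mathrm{cyc}(\sigma)-\mathrm{fix}(\sigma)}\alpha^{\mathrm{cyc}(\sigma)}t^{\mathrm{fix}(\sigma)};$$ $$\gamma_{n,j}(\alpha,t)=\sum_{\substack{\sigma\in\mathfrak{S}_{n+1}\\ \mathrm{dd}(\sigma)=0,\ \mathrm{des}(\sigma)=j}}\alpha^{\mathrm{lmax}(\sigma)+\mathrm{rmax}(\sigma)-2}t^{\mathrm{lmaxda}(\sigma)}=\sum_{\substack{\sigma\in\mathfrak{S}_n\\ \mathrm{cdd}(\sigma)=0,\ \mathrm{drop}(\sigma)=j}}2^{\mathrm{cyc}(\sigma)-\mathrm{fix}(\sigma)}\alpha^{\mathrm{cyc}(\sigma)}t^{\mathrm{fix}(\sigma)};$$ $$\gamma_{n,j}(\alpha,t)=2^{2j-n}\sum_{\substack{\sigma\in\mathfrak{S}_{n+1}\\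 \mathrm{pk}(\sigma)=j+1}}\alpha^{\mathrm{lmax}(\sigma)+\mathrm{rmax}(\sigma)-2}t^{\mathrm{lmaxda}(\sigma)+\mathrm{rmaxdd}(\sigma)}=2^{2j-n}\sum_{\substack{\sigma\in\mathfrak{S}_n\\ \mathrm{cpk}(\sigma)=j}}(2\alpha)^{\mathrm{cyc}(\sigma)}t^{\mathrm{fix}(\sigma)}.$$
   Context: $\mathfrak{S}_m$ is the symmetric group on $[m]$ ($\mathfrak{S}_0$ contains only the empty permutation); permutations are also written as words $\sigma=\sigma_1\cdots\sigma_m$. Linear statistics: $\mathrm{asc}$ (resp. $\mathrm{des}$) is the number of $1\le i\le m-1$ with $\sigma_i<\sigma_{i+1}$ (resp. $\sigma_i>\sigma_{i+1}$). With the convention $\sigma_0=\sigma_{m+1}=0$, a letter $\sigma_i$ ($1\le i\le m$) is a peak if $\sigma_{i-1}<\sigma_i>\sigma_{i+1}$, a double ascent if $\sigma_{i-1}<\sigma_i<\sigma_{i+1}$, a double descent if $\sigma_{i-1}>\sigma_i>\sigma_{i+1}$; their numbers are $\mathrm{pk},\mathrm{da},\mathrm{dd}$. $\sigma_i$ is a left-to-right (resp. right-to-left) maximum if it is larger than all letters of $\sigma$ to its left (resp. right); $\mathrm{lmax},\mathrm{rmax}$ are their numbers. $\mathrm{lmaxda}$ is the number of left-to-right maxima that are double ascents and $\mathrm{rmaxdd}$ the number of right-to-left maxima that are double descents. Cyclic statistics: $\mathrm{exc},\mathrm{drop},\mathrm{fix}$ count the $i$ with $i<\sigma(i)$, $i>\sigma(i)$,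 $i=\sigma(i)$; $\mathrm{cyc}$ is the number of cycles (fixed points included); $\mathrm{cpk},\mathrm{cda},\mathrm{cdd}$ count the $i$ with $\sigma^{-1}(i)<i>\sigma(i)$, $\sigma^{-1}(i)<i<\sigma(i)$, $\sigma^{-1}(i)>i>\sigma(i)$ respectively. The $(\alpha,t)$-Eulerian polynomials are $$A_n(x,y,t\,|\,\alpha)=\sum_{\sigma\in\mathfrak{S}_{n+1}}x^{\mathrm{asc}(\sigma)}y^{\mathrm{des}(\sigma)}t^{\mathrm{lmaxda}(\sigma)+\mathrm{rmaxdd}(\sigma)}\alpha^{\mathrm{lmax}(\sigma)+\mathrm{rmax}(\sigma)-2}.$$ *)

theory Defs
  imports Complex_Main "HOL-Combinatorics.Permutations" "HOL-Combinatorics.Orbits"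
begin

text \<open>
  A permutation of \<open>[m]\<close> is a function \<open>\<sigma>\<close> with \<open>\<sigma> permutes {1..m}\<close>; its word is
  \<open>\<sigma> 1, \<dots>, \<sigma> m\<close>. Since \<open>\<sigma>\<close> does not determine \<open>m\<close> (the function is the identity outside
  \<open>{1..m}\<close>), every statistic takes \<open>m\<close> as an argument.
\<close>

definition perms :: "nat \<Rightarrow> (nat \<Rightarrow> nat) set" where
  "perms m = {\<sigma>. \<sigma> permutes {1..m}}"


subsection \<open>Linear statistics\<close>

definition asc :: "nat \<Rightarrow> (nat \<Rightarrow> nat) \<Rightarrow> nat" where
  "asc m \<sigma> = card {i \<in> {1..<m}. \<sigma> i < \<sigma> (i + 1)}"

definition des :: "nat \<Rightarrow> (nat \<Rightarrow> nat) \<Rightarrow> nat" where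
  "des m \<sigma> = card {i \<in> {1..<m}. \<sigma> i > \<sigma> (i + 1)}"

text \<open>
  The word with the boundary convention \<open>\<sigma>\<^sub>0 = \<sigma>\<^sub>m\<^sub>+\<^sub>1 = 0\<close>; as a function, \<open>\<sigma>\<close> itself has
  \<open>\<sigma> (m + 1) = m + 1\<close>.
\<close>

definition letter :: "nat \<Rightarrow> (nat \<Rightarrow> nat) \<Rightarrow> nat \<Rightarrow> nat" where
  "letter m \<sigma> i = (if i \<in> {1..m} then \<sigma> i else 0)"

definition is_peak :: "nat \<Rightarrow> (nat \<Rightarrow> nat) \<Rightarrow> nat \<Rightarrow> bool" where
  "is_peak m \<sigma> i \<longleftrightarrow>
     letter m \<sigma> (i - 1) < letter m \<sigma> i \<and> letter m \<sigma> i > letter m \<sigma> (i + 1)"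

definition is_double_ascent :: "nat \<Rightarrow> (nat \<Rightarrow> nat) \<Rightarrow> nat \<Rightarrow> bool" where
  "is_double_ascent m \<sigma> i \<longleftrightarrow>
     letter m \<sigma> (i - 1) < letter m \<sigma> i \<and> letter m \<sigma> i < letter m \<sigma> (i + 1)"

definition is_double_descent :: "nat \<Rightarrow> (nat \<Rightarrow> nat) \<Rightarrow> nat \<Rightarrow> bool" where
  "is_double_descent m \<sigma> i \<longleftrightarrow>
     letter m \<sigma> (i - 1) > letter m \<sigma> i \<and> letter m \<sigma> i > letter m \<sigma> (i + 1)"

definition is_lr_max :: "(nat \<Rightarrow> nat) \<Rightarrow> nat \<Rightarrow> bool" where
  "is_lr_max \<sigma> i \<longleftrightarrow> (\<forall>k\<in>{1..<i}. \<sigma> k < \<sigma> i)"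

definition is_rl_max :: "nat \<Rightarrow> (nat \<Rightarrow> nat) \<Rightarrow> nat \<Rightarrow> bool" where
  "is_rl_max m \<sigma> i \<longleftrightarrow> (\<forall>k\<in>{i<..m}. \<sigma> k < \<sigma> i)"

definition pk :: "nat \<Rightarrow> (nat \<Rightarrow> nat) \<Rightarrow> nat" where
  "pk m \<sigma> = card {i \<in> {1..m}. is_peak m \<sigma> i}"

definition da :: "nat \<Rightarrow> (nat \<Rightarrow> nat) \<Rightarrow> nat" where
  "da m \<sigma> = card {i \<in> {1..m}. is_double_ascent m \<sigma> i}"

definition dd :: "nat \<Rightarrow> (nat \<Rightarrow> nat) \<Rightarrow> nat" where
  "dd m \<sigma> = card {i \<in> {1..m}. is_double_descent m \<sigma> i}"

definition lmax :: "nat \<Rightarrow> (nat \<Rightarrow> nat) \<Rightarrow> nat" where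
  "lmax m \<sigma> = card {i \<in> {1..m}. is_lr_max \<sigma> i}"

definition rmax :: "nat \<Rightarrow> (nat \<Rightarrow> nat) \<Rightarrow> nat" where
  "rmax m \<sigma> = card {i \<in> {1..m}. is_rl_max m \<sigma> i}"

definition lmaxda :: "nat \<Rightarrow> (nat \<Rightarrow> nat) \<Rightarrow> nat" where
  "lmaxda m \<sigma> = card {i \<in> {1..m}. is_lr_max \<sigma> i \<and> is_double_ascent m \<sigma> i}"

definition rmaxdd :: "nat \<Rightarrow> (nat \<Rightarrow> nat) \<Rightarrow> nat" where
  "rmaxdd m \<sigma> = card {i \<in> {1..m}. is_rl_max m \<sigma> i \<and> is_double_descent m \<sigma> i}"


subsection \<open>Cyclic statistics\<close>

definition exc :: "nat \<Rightarrow> (nat \<Rightarrow> nat) \<Rightarrow> nat" where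
  "exc m \<sigma> = card {i \<in> {1..m}. i < \<sigma> i}"

definition drops :: "nat \<Rightarrow> (nat \<Rightarrow> nat) \<Rightarrow> nat" where
  "drops m \<sigma> = card {i \<in> {1..m}. i > \<sigma> i}"

definition fixpts :: "nat \<Rightarrow> (nat \<Rightarrow> nat) \<Rightarrow> nat" where
  "fixpts m \<sigma> = card {i \<in> {1..m}. i = \<sigma> i}"

text \<open>Cycles are counted through their supports; a fixed point \<open>i\<close> contributes \<open>{i}\<close>.\<close>

definition cyc :: "nat \<Rightarrow> (nat \<Rightarrow> nat) \<Rightarrow> nat" where
  "cyc m \<sigma> = card (orbit \<sigma> ` {1..m})"

definition cpk :: "nat \<Rightarrow> (nat \<Rightarrow> nat) \<Rightarrow> nat" where
  "cpk m \<sigma> = card {i \<in> {1..m}. inv \<sigma> i < i \<and> i > \<sigma> i}"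

definition cda :: "nat \<Rightarrow> (nat \<Rightarrow> nat) \<Rightarrow> nat" where
  "cda m \<sigma> = card {i \<in> {1..m}. inv \<sigma> i < i \<and> i < \<sigma> i}"

definition cdd :: "nat \<Rightarrow> (nat \<Rightarrow> nat) \<Rightarrow> nat" where
  "cdd m \<sigma> = card {i \<in> {1..m}. inv \<sigma> i > i \<and> i > \<sigma> i}"


subsection \<open>The polynomials\<close>

text \<open>
  Polynomials are represented by their values at arbitrary elements of an arbitrary field of
  characteristic 0. As this includes the field of rational functions over the rationals, taken
  at the indeterminates, identities in this form are identities of polynomials.

  The truncated subtraction of 2 is harmless: \<open>lmax\<close> and \<open>rmax\<close> are positive on nonempty words.
\<close>

definition Eulerian_at ::
  "nat \<Rightarrow> 'a::field_char_0 \<Rightarrow> 'a \<Rightarrow> 'a \<Rightarrow> 'a \<Rightarrow> 'a" where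
  "Eulerian_at n x y t \<alpha> =
     (\<Sum>\<sigma>\<in>perms (n + 1).
        x ^ asc (n + 1) \<sigma> * y ^ des (n + 1) \<sigma>
        * t ^ (lmaxda (n + 1) \<sigma> + rmaxdd (n + 1) \<sigma>)
        * \<alpha> ^ (lmax (n + 1) \<sigma> + rmax (n + 1) \<sigma> - 2))"

definition gamma_coeff :: "nat \<Rightarrow> nat \<Rightarrow> 'a::field_char_0 \<Rightarrow> 'a \<Rightarrow> 'a" where
  "gamma_coeff n j \<alpha> t =
     (\<Sum>\<sigma> | \<sigma> \<in> perms (n + 1) \<and> da (n + 1) \<sigma> = 0 \<and> asc (n + 1) \<sigma> = j.
        \<alpha> ^ (lmax (n + 1) \<sigma> + rmax (n + 1) \<sigma> - 2) * t ^ rmaxdd (n + 1) \<sigma>)"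

end

theory Submission
  imports Defs "HOL-Computational_Algebra.Formal_Power_Series" "HOL-Computational_Algebra.Polynomial"
begin

text \<open>
The proof treats words and cycles as built by successive insertion of a new smallest letter. Give
each letter of a word a weight according to its type: \<open>1\<close> for peaks, \<open>w\<close> for valleys, \<open>a\<close> and \<open>a'\<close>
for double ascents that are, or are not, left-to-right maxima, \<open>d\<close> and \<open>d'\<close> for double descents that
are, or are not, right-to-left maxima. Inserting a smallest letter into an inner gap creates a valley
and changes the type of one letter, the smaller neighbour. Consequently the sum of the weights of all
words obtained in this way from a given one is the image of its weight under the derivation
\<open>a, a', d, d' \<mapsto> w\<close>, \<open>w \<mapsto> w (a' + d')\<close>,
and the two insertions at the ends contribute \<open>\<alpha> (a + d)\<close> times the weight. This is
\<open>word_sum_Suc\<close>. For permutations with weights \<open>f\<close> for fixed points, \<open>b\<close> and \<open>c\<close> for cyclic double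
ascents and descents, \<open>w\<close> for cyclic valleys and \<open>\<beta>\<close> for cycles, the same argument
(\<open>cycle_sum_insert\<close>) gives the derivation \<open>f, b, c \<mapsto> w\<close>, \<open>w \<mapsto> w (b + c)\<close> and the additional term
\<open>\<beta> f\<close>.

If \<open>a + d = 2 f\<close>, \<open>a' + d' = b + c\<close> and \<open>\<beta> = 2 \<alpha>\<close>, these relations are preserved by the derivations
and the two recurrences coincide, so the two weight enumerators are equal
(\<open>word_sum_eq_cycle_sum\<close>). In order to work with values instead of formal variables, the derivation
is realised as differentiation of formal power series: the prescribed values are the constant terms
of a power series solution of the corresponding differential equations (\<open>flow_exists\<close>).

In particular the enumerator of words depends on \<open>a, a', d, d'\<close> only through \<open>a + d\<close> and \<open>a' + d'\<close>.
The Eulerian polynomial is its value at \<open>a = t x\<close>, \<open>a' = x\<close>, \<open>d = t y\<close>, \<open>d' = y\<close>, \<open>w = x y\<close>. All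
weight may be moved to the descents, \<open>a = a' = 0\<close>, \<open>d = t (x + y)\<close>, \<open>d' = x + y\<close>, and then the only
words left are those without double ascents: this is the expansion. The other descriptions of the
coefficients arise in the same way from other distributions of the sums \<open>t\<close> and \<open>1\<close> (or \<open>2 t\<close> and
\<open>2\<close>) over ascents and descents, for words or for cycles, by comparing coefficients of the powers
of \<open>w\<close>.
\<close>

section \<open>Inserting the smallest letter into a word\<close>

text \<open>
With the convention that the word is preceded and followed by \<open>0\<close>, the type of a letter (peak,
valley, double ascent, double descent) is determined by two bits: whether the word rises to the
letter and whether it falls from it. In these terms insertion of the smallest letter is easy to
describe: it switches on the fall of its left neighbour and the rise to its right neighbour,
and changes nothing else.
\<close>

definition rises_to :: "nat \<Rightarrow> (nat \<Rightarrow> nat) \<Rightarrow> nat \<Rightarrow> bool" where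
  "rises_to m \<sigma> i \<longleftrightarrow> letter m \<sigma> (i - 1) < letter m \<sigma> i"

definition falls_from :: "nat \<Rightarrow> (nat \<Rightarrow> nat) \<Rightarrow> nat \<Rightarrow> bool" where
  "falls_from m \<sigma> i \<longleftrightarrow> letter m \<sigma> (i + 1) < letter m \<sigma> i"

text \<open>
All letters are raised by one to make room for the new smallest letter \<open>1\<close>, which is put between
the old positions \<open>p\<close> and \<open>p + 1\<close>. The value at \<open>0\<close> makes the result fix every point outside the
positions of the word; beyond the end of the word this happens by itself, since there
\<open>\<sigma> (i - 1) = i - 1\<close>.
\<close>

definition insert_min :: "nat \<Rightarrow> (nat \<Rightarrow> nat) \<Rightarrow> nat \<Rightarrow> nat" where
  "insert_min p \<sigma> i =
     (if i = 0 then 0 else if i \<le> p then Suc (\<sigma> i) else if i = Suc p then 1 else Suc (\<sigma> (i - 1)))"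

definition shift :: "nat \<Rightarrow> nat \<Rightarrow> nat" where
  "shift p i = (if i \<le> p then i else Suc i)"

lemma perms_value:
  assumes "\<sigma> \<in> perms m" "1 \<le> i" "i \<le> m"
  shows "1 \<le> \<sigma> i" "\<sigma> i \<le> m"
proof -
  have "\<sigma> i \<in> {1..m}"
    using assms permutes_in_image[of \<sigma> "{1..m}" i] by (simp add: perms_def)
  then show "1 \<le> \<sigma> i" "\<sigma> i \<le> m" by auto
qed

lemma perms_inj: "\<sigma> \<in> perms m \<Longrightarrow> inj \<sigma>"
  by (auto simp: perms_def intro: permutes_inj)

lemma perms_outside: "\<sigma> \<in> perms m \<Longrightarrow> m < i \<Longrightarrow> \<sigma> i = i"
  by (auto simp: perms_def permutes_def)

lemma perms_zero: "\<sigma> \<in> perms m \<Longrightarrow> \<sigma> 0 = 0"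
  by (auto simp: perms_def permutes_def)

lemma finite_perms: "finite (perms m)"
  by (simp add: perms_def finite_permutations)

lemma card_perms: "card (perms m) = fact m"
  unfolding perms_def by (rule card_permutations) simp_all

lemma perms_Suc_0: "perms (Suc 0) = {id}"
  by (auto simp: perms_def)

lemma insert_min_shift: "1 \<le> i \<Longrightarrow> insert_min p \<sigma> (shift p i) = Suc (\<sigma> i)"
  by (auto simp: insert_min_def shift_def)

lemma insert_min_new: "insert_min p \<sigma> (Suc p) = 1"
  by (auto simp: insert_min_def)

lemma inj_shift: "inj (shift p)"
  by (auto simp: inj_def shift_def split: if_splits)

lemma positions_insert: "p \<le> m \<Longrightarrow> {1..Suc m} = insert (Suc p) (shift p ` {1..m})"
proof (intro equalityI subsetI)
  fix i assume "p \<le> m" "i \<in> {1..Suc m}"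
  then show "i \<in> insert (Suc p) (shift p ` {1..m})"
    by (cases "i \<le> p"; cases "i = Suc p"; cases i) (auto simp: shift_def image_iff)
qed (auto simp: shift_def split: if_splits)

lemma new_position: "Suc p \<notin> shift p ` A"
  by (auto simp: shift_def)

lemma insert_min_perms:
  assumes "\<sigma> \<in> perms m" "p \<le> m"
  shows "insert_min p \<sigma> \<in> perms (Suc m)"
  unfolding perms_def mem_Collect_eq
proof (rule inj_imp_permutes)
  have *: "i = j" if "1 \<le> i" "1 \<le> j" "insert_min p \<sigma> (shift p i) = insert_min p \<sigma> (shift p j)" for i j
    using that perms_inj[OF assms(1)] by (simp add: insert_min_shift inj_eq)
  have **: "insert_min p \<sigma> (Suc p) \<noteq> insert_min p \<sigma> (shift p i)" if "i \<in> {1..m}" for i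
    using that perms_value[OF assms(1), of i] by (simp add: insert_min_shift insert_min_new)
  show "inj_on (insert_min p \<sigma>) {1..Suc m}"
    unfolding positions_insert[OF assms(2)] inj_on_insert
  proof
    show "inj_on (insert_min p \<sigma>) (shift p ` {1..m})"
    proof (rule inj_onI, elim imageE)
      fix k l i j
      assume "insert_min p \<sigma> k = insert_min p \<sigma> l"
        "k = shift p i" "i \<in> {1..m}" "l = shift p j" "j \<in> {1..m}"
      then show "k = l" using *[of i j] by simp
    qed
    show "insert_min p \<sigma> (Suc p) \<notin> insert_min p \<sigma> ` (shift p ` {1..m} - {Suc p})"
      using ** by blast
  qed
  show "insert_min p \<sigma> i \<in> {1..Suc m}" if "i \<in> {1..Suc m}" for i
  proof (cases "i = Suc p")
    case False
    with that obtain k where "i = shift p k" "k \<in> {1..m}"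
      unfolding positions_insert[OF assms(2)] by blast
    then show ?thesis
      using perms_value[OF assms(1), of k] by (simp add: insert_min_shift)
  qed (simp add: insert_min_new)
  show "insert_min p \<sigma> i = i" if "i \<notin> {1..Suc m}" for i
    using that assms perms_outside[OF assms(1), of "i - 1"] by (auto simp: insert_min_def)
qed simp

text \<open>
The place of the letter \<open>1\<close> gives back \<open>p\<close>, so insertion is injective; surjectivity then follows
from \<open>(m + 1) * m! = (m + 1)!\<close> by counting.
\<close>

lemma bij_betw_insert_min:
  "bij_betw (\<lambda>(p, \<sigma>). insert_min p \<sigma>) ({0..m} \<times> perms m) (perms (Suc m))"
proof -
  let ?f = "\<lambda>(p, \<sigma>). insert_min p \<sigma>"
  have inj: "inj_on ?f ({0..m} \<times> perms m)"
  proof (rule inj_onI, clarify)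
    fix p \<sigma> p' \<sigma>'
    assume p: "p \<in> {0..m}" "p' \<in> {0..m}" and \<sigma>: "\<sigma> \<in> perms m" "\<sigma>' \<in> perms m"
      and eq: "insert_min p \<sigma> = insert_min p' \<sigma>'"
    have "insert_min p \<sigma> (Suc p) = insert_min p \<sigma> (Suc p')"
      using eq insert_min_new by metis
    then have "p = p'"
      using perms_inj[OF insert_min_perms[OF \<sigma>(1), of p]] p(1) by (simp add: inj_eq)
    moreover have "\<sigma> i = \<sigma>' i" for i
      using insert_min_shift[of i p] eq \<open>p = p'\<close> perms_zero[OF \<sigma>(1)] perms_zero[OF \<sigma>(2)]
      by (cases "i = 0") (simp_all, metis One_nat_def Suc_le_eq nat.inject neq0_conv)
    ultimately show "p = p' \<and> \<sigma> = \<sigma>'" by auto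
  qed
  have "?f ` ({0..m} \<times> perms m) \<subseteq> perms (Suc m)"
    using insert_min_perms by auto
  moreover have "card (perms (Suc m)) \<le> card (?f ` ({0..m} \<times> perms m))"
    by (simp add: card_image[OF inj] card_cartesian_product card_perms)
  ultimately have "?f ` ({0..m} \<times> perms m) = perms (Suc m)"
    using card_seteq finite_perms by blast
  with inj show ?thesis by (simp add: bij_betw_def)
qed

lemma rises_to_1: "\<sigma> \<in> perms m \<Longrightarrow> 1 \<le> m \<Longrightarrow> rises_to m \<sigma> (Suc 0)"
  using perms_value(1)[of \<sigma> m 1] by (auto simp: rises_to_def letter_def)

lemma falls_from_last: "\<sigma> \<in> perms m \<Longrightarrow> 1 \<le> m \<Longrightarrow> falls_from m \<sigma> m"
  using perms_value(1)[of \<sigma> m m] by (auto simp: falls_from_def letter_def)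

lemma rises_to_Suc_iff:
  assumes "\<sigma> \<in> perms m" "1 \<le> p" "p < m"
  shows "rises_to m \<sigma> (Suc p) \<longleftrightarrow> \<not> falls_from m \<sigma> p"
proof -
  have "\<sigma> p \<noteq> \<sigma> (Suc p)"
    using perms_inj[OF assms(1)] by (simp add: inj_eq)
  then show ?thesis
    using assms by (auto simp: rises_to_def falls_from_def letter_def)
qed

lemma is_lr_max_imp_rises_to:
  assumes "\<sigma> \<in> perms m" "1 \<le> i" "i \<le> m" "is_lr_max \<sigma> i"
  shows "rises_to m \<sigma> i"
  using assms perms_value[OF assms(1), of i]
  by (cases "i = 1") (auto simp: is_lr_max_def rises_to_def letter_def)

lemma is_rl_max_imp_falls_from:
  assumes "\<sigma> \<in> perms m" "1 \<le> i" "i \<le> m" "is_rl_max m \<sigma> i"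
  shows "falls_from m \<sigma> i"
  using assms perms_value[OF assms(1), of i]
  by (cases "i = m") (auto simp: is_rl_max_def falls_from_def letter_def)

text \<open>
The new letter is smaller than all others, so an old letter to whose left it is placed is preceded by
a rise from then on; all other comparisons are between the same letters, or with a final zero, as
before.
\<close>

lemma rises_to_shift:
  assumes "\<sigma> \<in> perms m" "p \<le> m" "1 \<le> i" "i \<le> m"
  shows "rises_to (Suc m) (insert_min p \<sigma>) (shift p i) \<longleftrightarrow> i = Suc p \<or> rises_to m \<sigma> i"
  using assms perms_value[OF assms(1), of i]
  by (auto simp: rises_to_def letter_def insert_min_def shift_def)

lemma falls_from_shift:
  assumes "\<sigma> \<in> perms m" "p \<le> m" "1 \<le> i" "i \<le> m"
  shows "falls_from (Suc m) (insert_min p \<sigma>) (shift p i) \<longleftrightarrow> i = p \<or> falls_from m \<sigma> i"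
  using assms perms_value[OF assms(1), of i]
  by (auto simp: falls_from_def letter_def insert_min_def shift_def)

lemma shift_less_iff: "shift p k < shift p i \<longleftrightarrow> k < i"
  by (auto simp: shift_def)

lemma is_lr_max_iff:
  "i \<le> m \<Longrightarrow> is_lr_max \<sigma> i \<longleftrightarrow> (\<forall>k\<in>{1..m}. k < i \<longrightarrow> \<sigma> k < \<sigma> i)"
  by (auto simp: is_lr_max_def)

lemma is_rl_max_iff:
  "1 \<le> i \<Longrightarrow> is_rl_max m \<sigma> i \<longleftrightarrow> (\<forall>k\<in>{1..m}. i < k \<longrightarrow> \<sigma> k < \<sigma> i)"
  by (auto simp: is_rl_max_def)

text \<open>A smaller letter never prevents another letter from being a maximum.\<close>

lemma is_lr_max_shift:
  assumes "\<sigma> \<in> perms m" "p \<le> m" "1 \<le> i" "i \<le> m"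
  shows "is_lr_max (insert_min p \<sigma>) (shift p i) \<longleftrightarrow> is_lr_max \<sigma> i"
proof -
  have "shift p i \<le> Suc m" using assms by (simp add: shift_def)
  then show ?thesis
    using assms perms_value(1)[OF assms(1,3,4)]
    unfolding is_lr_max_iff[OF \<open>shift p i \<le> Suc m\<close>] is_lr_max_iff[OF assms(4)]
      positions_insert[OF assms(2)]
    by (auto simp: insert_min_shift insert_min_new shift_less_iff)
qed

lemma is_rl_max_shift:
  assumes "\<sigma> \<in> perms m" "p \<le> m" "1 \<le> i" "i \<le> m"
  shows "is_rl_max (Suc m) (insert_min p \<sigma>) (shift p i) \<longleftrightarrow> is_rl_max m \<sigma> i"
proof -
  have "1 \<le> shift p i" using assms by (simp add: shift_def)
  then show ?thesis
    using assms perms_value(1)[OF assms(1,3,4)]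
    unfolding is_rl_max_iff[OF \<open>1 \<le> shift p i\<close>] is_rl_max_iff[OF assms(3)]
      positions_insert[OF assms(2)]
    by (auto simp: insert_min_shift insert_min_new shift_less_iff)
qed

text \<open>
The new letter is a valley unless it stands at an end of the word, where the surrounding zeros make
it a double ascent (and left-to-right maximum) or a double descent (and right-to-left maximum).
\<close>

lemma new_letter:
  assumes "\<sigma> \<in> perms m" "1 \<le> m" "p \<le> m"
  shows "rises_to (Suc m) (insert_min p \<sigma>) (Suc p) \<longleftrightarrow> p = 0"
    and "falls_from (Suc m) (insert_min p \<sigma>) (Suc p) \<longleftrightarrow> p = m"
    and "is_lr_max (insert_min p \<sigma>) (Suc p) \<longleftrightarrow> p = 0"
    and "is_rl_max (Suc m) (insert_min p \<sigma>) (Suc p) \<longleftrightarrow> p = m"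
proof -
  show "rises_to (Suc m) (insert_min p \<sigma>) (Suc p) \<longleftrightarrow> p = 0"
    using assms by (auto simp: rises_to_def letter_def insert_min_def)
  show "falls_from (Suc m) (insert_min p \<sigma>) (Suc p) \<longleftrightarrow> p = m"
    using assms by (auto simp: falls_from_def letter_def insert_min_def)
  show "is_lr_max (insert_min p \<sigma>) (Suc p) \<longleftrightarrow> p = 0"
    using assms perms_value(1)[OF assms(1), of 1]
    by (force simp: is_lr_max_def insert_min_def Suc_le_eq)
  show "is_rl_max (Suc m) (insert_min p \<sigma>) (Suc p) \<longleftrightarrow> p = m"
    using assms perms_value(1)[OF assms(1), of m]
    by (force simp: is_rl_max_def insert_min_def Suc_le_eq)
qed

lemma card_positions_insert:
  assumes "p \<le> m"
  shows "card {i \<in> {1..Suc m}. P i} = of_bool (P (Suc p)) + card {i \<in> {1..m}. P (shift p i)}"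
proof -
  have "{i \<in> {1..Suc m}. P i}
      = (if P (Suc p) then {Suc p} else {}) \<union> shift p ` {i \<in> {1..m}. P (shift p i)}"
    unfolding positions_insert[OF assms] by auto
  moreover have "card (shift p ` {i \<in> {1..m}. P (shift p i)}) = card {i \<in> {1..m}. P (shift p i)}"
    by (intro card_image inj_on_subset[OF inj_shift]) simp
  ultimately show ?thesis using new_position[of p] by (auto simp: card_insert_if)
qed

lemma lmax_insert_min:
  assumes "\<sigma> \<in> perms m" "1 \<le> m" "p \<le> m"
  shows "lmax (Suc m) (insert_min p \<sigma>) = lmax m \<sigma> + of_bool (p = 0)"
  unfolding lmax_def card_positions_insert[OF assms(3)]
  using assms by (simp add: new_letter is_lr_max_shift cong: conj_cong)

lemma rmax_insert_min:
  assumes "\<sigma> \<in> perms m" "1 \<le> m" "p \<le> m"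
  shows "rmax (Suc m) (insert_min p \<sigma>) = rmax m \<sigma> + of_bool (p = m)"
  unfolding rmax_def card_positions_insert[OF assms(3)]
  using assms by (simp add: new_letter is_rl_max_shift cong: conj_cong)

lemma lmax_pos:
  assumes "1 \<le> m" shows "1 \<le> lmax m \<sigma>"
proof -
  have "1 \<in> {i \<in> {1..m}. is_lr_max \<sigma> i}"
    using assms by (auto simp: is_lr_max_def)
  then have "card {i \<in> {1..m}. is_lr_max \<sigma> i} \<noteq> 0"
    by (subst card_0_eq) auto
  then show ?thesis unfolding lmax_def by linarith
qed

lemma rmax_pos:
  assumes "1 \<le> m" shows "1 \<le> rmax m \<sigma>"
proof -
  have "m \<in> {i \<in> {1..m}. is_rl_max m \<sigma> i}"
    using assms by (auto simp: is_rl_max_def)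
  then have "card {i \<in> {1..m}. is_rl_max m \<sigma> i} \<noteq> 0"
    by (subst card_0_eq) auto
  then show ?thesis unfolding rmax_def by linarith
qed

section \<open>The differential recurrence for words\<close>

lemma fps_deriv_prod:
  fixes c :: "'i \<Rightarrow> 'a::comm_ring_1 fps"
  assumes "finite S"
  shows "fps_deriv (\<Prod>i\<in>S. c i) = (\<Sum>k\<in>S. fps_deriv (c k) * (\<Prod>i\<in>S - {k}. c i))"
  using assms
proof (induction S)
  case (insert j S)
  have *: "(\<Prod>i\<in>insert j S - {k}. c i) = c j * (\<Prod>i\<in>S - {k}. c i)" if "k \<in> S" for k
  proof -
    have "insert j S - {k} = insert j (S - {k})" using that insert.hyps by auto
    then show ?thesis using insert.hyps by simp
  qed
  have "(\<Sum>k\<in>insert j S. fps_deriv (c k) * (\<Prod>i\<in>insert j S - {k}. c i))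
      = fps_deriv (c j) * (\<Prod>i\<in>S. c i) + (\<Sum>k\<in>S. fps_deriv (c k) * (c j * (\<Prod>i\<in>S - {k}. c i)))"
    using insert.hyps * by simp
  also have "\<dots> = fps_deriv (c j) * (\<Prod>i\<in>S. c i) + c j * fps_deriv (\<Prod>i\<in>S. c i)"
    by (simp add: insert.IH sum_distrib_left mult.left_commute)
  finally show ?case using insert.hyps by (simp add: algebra_simps)
qed simp

lemma prod_eq_except:
  fixes c :: "'i \<Rightarrow> 'r::comm_monoid_mult"
  assumes "finite S" "k \<in> S" "\<And>i. i \<in> S \<Longrightarrow> i \<noteq> k \<Longrightarrow> c' i = c i"
  shows "(\<Prod>i\<in>S. c' i) = c' k * (\<Prod>i\<in>S - {k}. c i)"
  using assms by (simp add: prod.remove)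

text \<open>
Peaks need no weight of their own, since a word has exactly one more peak than valleys. The
arguments \<open>lr\<close> and \<open>rl\<close> tell whether the letter is a left-to-right or right-to-left maximum.
\<close>

definition letter_factor ::
  "'r::comm_ring_1 \<Rightarrow> 'r \<Rightarrow> 'r \<Rightarrow> 'r \<Rightarrow> 'r \<Rightarrow> bool \<Rightarrow> bool \<Rightarrow> bool \<Rightarrow> bool \<Rightarrow> 'r" where
  "letter_factor a a' d d' w rise fall lr rl =
     (if rise then if fall then 1 else if lr then a else a'
      else if fall then if rl then d else d' else w)"

definition word_factor ::
  "'r::comm_ring_1 \<Rightarrow> 'r \<Rightarrow> 'r \<Rightarrow> 'r \<Rightarrow> 'r \<Rightarrow> nat \<Rightarrow> (nat \<Rightarrow> nat) \<Rightarrow> nat \<Rightarrow> 'r" where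
  "word_factor a a' d d' w m \<sigma> i =
     letter_factor a a' d d' w (rises_to m \<sigma> i) (falls_from m \<sigma> i) (is_lr_max \<sigma> i) (is_rl_max m \<sigma> i)"

definition word_prod ::
  "'r::comm_ring_1 \<Rightarrow> 'r \<Rightarrow> 'r \<Rightarrow> 'r \<Rightarrow> 'r \<Rightarrow> nat \<Rightarrow> (nat \<Rightarrow> nat) \<Rightarrow> 'r" where
  "word_prod a a' d d' w m \<sigma> = (\<Prod>i\<in>{1..m}. word_factor a a' d d' w m \<sigma> i)"

text \<open>
The index is shifted as for the Eulerian polynomials, so that \<open>n\<close> is the number of insertions
needed to build the word from a single letter.
\<close>

definition word_sum ::
  "'r::comm_ring_1 \<Rightarrow> 'r \<Rightarrow> 'r \<Rightarrow> 'r \<Rightarrow> 'r \<Rightarrow> 'r \<Rightarrow> nat \<Rightarrow> 'r" where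
  "word_sum a a' d d' w \<alpha> n =
     (\<Sum>\<sigma>\<in>perms (Suc n). \<alpha> ^ (lmax (Suc n) \<sigma> + rmax (Suc n) \<sigma> - 2) * word_prod a a' d d' w (Suc n) \<sigma>)"

lemma word_prod_insert_min:
  assumes "\<sigma> \<in> perms m" "1 \<le> m" "p \<le> m"
  shows "word_prod a a' d d' w (Suc m) (insert_min p \<sigma>) =
    letter_factor a a' d d' w (p = 0) (p = m) (p = 0) (p = m) *
    (\<Prod>i\<in>{1..m}. letter_factor a a' d d' w (i = Suc p \<or> rises_to m \<sigma> i) (i = p \<or> falls_from m \<sigma> i)
                     (is_lr_max \<sigma> i) (is_rl_max m \<sigma> i))"
proof -
  have "word_prod a a' d d' w (Suc m) (insert_min p \<sigma>) =
      word_factor a a' d d' w (Suc m) (insert_min p \<sigma>) (Suc p) *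
      (\<Prod>i\<in>shift p ` {1..m}. word_factor a a' d d' w (Suc m) (insert_min p \<sigma>) i)"
    unfolding word_prod_def positions_insert[OF assms(3)]
    by (rule prod.insert) (simp_all add: new_position)
  also have "(\<Prod>i\<in>shift p ` {1..m}. word_factor a a' d d' w (Suc m) (insert_min p \<sigma>) i) =
      (\<Prod>i\<in>{1..m}. word_factor a a' d d' w (Suc m) (insert_min p \<sigma>) (shift p i))"
    by (subst prod.reindex) (auto intro: inj_on_subset[OF inj_shift])
  finally show ?thesis
    using assms
    by (simp add: word_factor_def new_letter rises_to_shift falls_from_shift
        is_lr_max_shift is_rl_max_shift)
qed

lemma word_prod_insert_front:
  assumes "\<sigma> \<in> perms m" "1 \<le> m"
  shows "word_prod a a' d d' w (Suc m) (insert_min 0 \<sigma>) = a * word_prod a a' d d' w m \<sigma>"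
proof -
  have "i = Suc 0 \<or> rises_to m \<sigma> i \<longleftrightarrow> rises_to m \<sigma> i" "i = 0 \<or> falls_from m \<sigma> i \<longleftrightarrow> falls_from m \<sigma> i"
    if "i \<in> {1..m}" for i
    using that assms rises_to_1[OF assms] by auto
  then have "(\<Prod>i\<in>{1..m}. letter_factor a a' d d' w (i = Suc 0 \<or> rises_to m \<sigma> i) (i = 0 \<or> falls_from m \<sigma> i)
                 (is_lr_max \<sigma> i) (is_rl_max m \<sigma> i)) = word_prod a a' d d' w m \<sigma>"
    unfolding word_prod_def word_factor_def by (intro prod.cong refl) (simp only:)
  then show ?thesis
    unfolding word_prod_insert_min[OF assms le0] using assms by (simp add: letter_factor_def)
qed

lemma word_prod_insert_back:
  assumes "\<sigma> \<in> perms m" "1 \<le> m"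
  shows "word_prod a a' d d' w (Suc m) (insert_min m \<sigma>) = d * word_prod a a' d d' w m \<sigma>"
proof -
  have "i = Suc m \<or> rises_to m \<sigma> i \<longleftrightarrow> rises_to m \<sigma> i" "i = m \<or> falls_from m \<sigma> i \<longleftrightarrow> falls_from m \<sigma> i"
    if "i \<in> {1..m}" for i
    using that assms falls_from_last[OF assms] by auto
  then have "(\<Prod>i\<in>{1..m}. letter_factor a a' d d' w (i = Suc m \<or> rises_to m \<sigma> i) (i = m \<or> falls_from m \<sigma> i)
                 (is_lr_max \<sigma> i) (is_rl_max m \<sigma> i)) = word_prod a a' d d' w m \<sigma>"
    unfolding word_prod_def word_factor_def by (intro prod.cong refl) (simp only:)
  then show ?thesis
    unfolding word_prod_insert_min[OF assms order.refl] using assms by (simp add: letter_factor_def)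
qed

text \<open>
Between two letters only the smaller neighbour changes its type. The larger one already rises or
falls on the side of the gap, so the bit that the insertion switches on was on before.
\<close>

lemma word_prod_insert_inside:
  assumes "\<sigma> \<in> perms m" "1 \<le> p" "p < m"
  shows "word_prod a a' d d' w (Suc m) (insert_min p \<sigma>) = w *
    (if falls_from m \<sigma> p
     then letter_factor a a' d d' w True (falls_from m \<sigma> (Suc p)) (is_lr_max \<sigma> (Suc p)) (is_rl_max m \<sigma> (Suc p))
       * (\<Prod>i\<in>{1..m} - {Suc p}. word_factor a a' d d' w m \<sigma> i)
     else letter_factor a a' d d' w (rises_to m \<sigma> p) True (is_lr_max \<sigma> p) (is_rl_max m \<sigma> p)
       * (\<Prod>i\<in>{1..m} - {p}. word_factor a a' d d' w m \<sigma> i))"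
proof -
  let ?c = "\<lambda>i. letter_factor a a' d d' w (i = Suc p \<or> rises_to m \<sigma> i) (i = p \<or> falls_from m \<sigma> i)
                     (is_lr_max \<sigma> i) (is_rl_max m \<sigma> i)"
  \<comment> \<open>the smaller of the two neighbours of the gap\<close>
  define k where "k = (if falls_from m \<sigma> p then Suc p else p)"
  have "(\<Prod>i\<in>{1..m}. ?c i) = ?c k * (\<Prod>i\<in>{1..m} - {k}. word_factor a a' d d' w m \<sigma> i)"
  proof (rule prod_eq_except)
    fix i assume "i \<in> {1..m}" "i \<noteq> k"
    with rises_to_Suc_iff[OF assms]
    have "i = Suc p \<or> rises_to m \<sigma> i \<longleftrightarrow> rises_to m \<sigma> i" "i = p \<or> falls_from m \<sigma> i \<longleftrightarrow> falls_from m \<sigma> i"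
      by (auto simp: k_def split: if_splits)
    then show "?c i = word_factor a a' d d' w m \<sigma> i"
      by (simp add: word_factor_def)
  qed (use assms in \<open>auto simp: k_def\<close>)
  with assms show ?thesis
    by (simp add: word_prod_insert_min k_def letter_factor_def[of a a' d d' w False False])
qed

text \<open>
Each letter that is not a peak is the smaller neighbour at one gap (double ascents and descents) or
at both gaps (valleys) next to it. The derivative of its weight is the sum over these gaps of \<open>w\<close>,
the weight of the new valley, times its weight after the insertion: double ascents and descents
become peaks, and a valley becomes a double descent or a double ascent, which is no maximum of the
relevant kind because the letter beyond the new one is larger.
\<close>

lemma deriv_word_factor:
  fixes a a' d d' w :: "'a::comm_ring_1 fps"
  assumes "\<sigma> \<in> perms m" "1 \<le> i" "i \<le> m"
    and "fps_deriv a = w" "fps_deriv a' = w" "fps_deriv d = w" "fps_deriv d' = w"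
    and "fps_deriv w = w * (a' + d')"
  shows "fps_deriv (word_factor a a' d d' w m \<sigma> i) =
    (if falls_from m \<sigma> i then 0
     else w * letter_factor a a' d d' w (rises_to m \<sigma> i) True (is_lr_max \<sigma> i) (is_rl_max m \<sigma> i)) +
    (if rises_to m \<sigma> i then 0
     else w * letter_factor a a' d d' w True (falls_from m \<sigma> i) (is_lr_max \<sigma> i) (is_rl_max m \<sigma> i))"
  using assms is_lr_max_imp_rises_to[OF assms(1-3)] is_rl_max_imp_falls_from[OF assms(1-3)]
  by (auto simp: word_factor_def letter_factor_def algebra_simps)

text \<open>
By the Leibniz rule the derivative of the weight of a word is a sum over its letters; charging every
inner gap to its smaller neighbour turns the sum over all insertions into this sum.
\<close>

lemma sum_word_prod_insert_inside:
  fixes a a' d d' w :: "'a::comm_ring_1 fps"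
  assumes \<sigma>: "\<sigma> \<in> perms m" and m: "1 \<le> m"
    and deriv: "fps_deriv a = w" "fps_deriv a' = w" "fps_deriv d = w" "fps_deriv d' = w"
      "fps_deriv w = w * (a' + d')"
  shows "(\<Sum>p\<in>{1..<m}. word_prod a a' d d' w (Suc m) (insert_min p \<sigma>))
       = fps_deriv (word_prod a a' d d' w m \<sigma>)"
proof -
  define P where "P k = (\<Prod>i\<in>{1..m} - {k}. word_factor a a' d d' w m \<sigma> i)" for k
  define f where "f k = w * letter_factor a a' d d' w (rises_to m \<sigma> k) True (is_lr_max \<sigma> k) (is_rl_max m \<sigma> k) * P k" for k
  define g where "g k = w * letter_factor a a' d d' w True (falls_from m \<sigma> k) (is_lr_max \<sigma> k) (is_rl_max m \<sigma> k) * P k" for k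
  have "(\<Sum>p\<in>{1..<m}. word_prod a a' d d' w (Suc m) (insert_min p \<sigma>))
      = (\<Sum>p\<in>{1..<m}. (if falls_from m \<sigma> p then 0 else f p) + (if rises_to m \<sigma> (Suc p) then 0 else g (Suc p)))"
    using \<sigma> by (intro sum.cong) (auto simp: word_prod_insert_inside f_def g_def P_def rises_to_Suc_iff mult.assoc)
  also have "\<dots> = (\<Sum>p\<in>{1..<m}. if falls_from m \<sigma> p then 0 else f p)
      + (\<Sum>p\<in>{1..<m}. if rises_to m \<sigma> (Suc p) then 0 else g (Suc p))"
    by (rule sum.distrib)
  \<comment> \<open>The last letter always falls to the final zero, so the gap behind it contributes nothing.\<close>
  also have "(\<Sum>p\<in>{1..<m}. if falls_from m \<sigma> p then 0 else f p) = (\<Sum>i\<in>{1..m}. if falls_from m \<sigma> i then 0 else f i)"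
  proof (rule sum.mono_neutral_left)
    have "{1..m} - {1..<m} = {m}" using m by auto
    then show "\<forall>i\<in>{1..m} - {1..<m}. (if falls_from m \<sigma> i then 0 else f i) = 0"
      using falls_from_last[OF \<sigma> m] by simp
  qed auto
  \<comment> \<open>Here the gap is charged to the letter on its right; the first letter always rises.\<close>
  also have "(\<Sum>p\<in>{1..<m}. if rises_to m \<sigma> (Suc p) then 0 else g (Suc p))
      = (\<Sum>i\<in>Suc ` {1..<m}. if rises_to m \<sigma> i then 0 else g i)"
    by (subst sum.reindex) auto
  also have "\<dots> = (\<Sum>i\<in>{1..m}. if rises_to m \<sigma> i then 0 else g i)"
  proof (rule sum.mono_neutral_left)
    have "{1..m} - Suc ` {1..<m} = {1}" using m by (auto simp: image_iff gr0_conv_Suc Suc_le_eq)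
    then show "\<forall>i\<in>{1..m} - Suc ` {1..<m}. (if rises_to m \<sigma> i then 0 else g i) = 0"
      using rises_to_1[OF \<sigma> m] by simp
  qed auto
  also have "(\<Sum>i\<in>{1..m}. if falls_from m \<sigma> i then 0 else f i) + (\<Sum>i\<in>{1..m}. if rises_to m \<sigma> i then 0 else g i)
      = (\<Sum>k\<in>{1..m}. fps_deriv (word_factor a a' d d' w m \<sigma> k) * P k)"
    unfolding sum.distrib[symmetric]
    by (intro sum.cong refl) (auto simp: deriv_word_factor[OF \<sigma> _ _ deriv] f_def g_def algebra_simps)
  also have "\<dots> = fps_deriv (word_prod a a' d d' w m \<sigma>)"
    unfolding word_prod_def P_def by (rule fps_deriv_prod[symmetric]) simp
  finally show ?thesis .
qed

lemma word_sum_0: "word_sum a a' d d' w \<alpha> 0 = 1"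
proof -
  have "{i \<in> {1..Suc 0}. is_lr_max id i} = {1}" "{i \<in> {1..Suc 0}. is_rl_max (Suc 0) id i} = {1}"
    by (auto simp: is_lr_max_def is_rl_max_def)
  then have "lmax (Suc 0) id = 1" "rmax (Suc 0) id = 1"
    by (simp_all add: lmax_def rmax_def)
  moreover have "rises_to (Suc 0) id (Suc 0)" "falls_from (Suc 0) id (Suc 0)"
    by (simp_all add: rises_to_def falls_from_def letter_def)
  ultimately show ?thesis
    by (simp add: word_sum_def perms_Suc_0 word_prod_def word_factor_def letter_factor_def)
qed

text \<open>
An insertion inside the word keeps the numbers of maxima; the insertions at the two ends create one
new maximum each, which is the origin of the term \<open>\<alpha> * (a + d)\<close>.
\<close>

lemma word_sum_Suc:
  fixes a a' d d' w \<alpha> :: "'a::comm_ring_1 fps"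
  assumes deriv: "fps_deriv a = w" "fps_deriv a' = w" "fps_deriv d = w" "fps_deriv d' = w"
      "fps_deriv w = w * (a' + d')" "fps_deriv \<alpha> = 0"
  shows "word_sum a a' d d' w \<alpha> (Suc n) =
    fps_deriv (word_sum a a' d d' w \<alpha> n) + \<alpha> * (a + d) * word_sum a a' d d' w \<alpha> n"
proof -
  define m where "m = Suc n"
  have m: "1 \<le> m" by (simp add: m_def)
  let ?W = "word_prod a a' d d' w"
  have "word_sum a a' d d' w \<alpha> (Suc n) = (\<Sum>\<tau>\<in>perms (Suc m). \<alpha> ^ (lmax (Suc m) \<tau> + rmax (Suc m) \<tau> - 2) * ?W (Suc m) \<tau>)"
    by (simp add: word_sum_def m_def)
  also have "\<dots> = (\<Sum>(p, \<sigma>)\<in>{0..m} \<times> perms m.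
      \<alpha> ^ (lmax (Suc m) (insert_min p \<sigma>) + rmax (Suc m) (insert_min p \<sigma>) - 2) * ?W (Suc m) (insert_min p \<sigma>))"
    by (subst sum.reindex_bij_betw[OF bij_betw_insert_min, symmetric]) (simp add: case_prod_unfold)
  also have "\<dots> = (\<Sum>\<sigma>\<in>perms m. \<Sum>p\<in>{0..m}.
      \<alpha> ^ (lmax (Suc m) (insert_min p \<sigma>) + rmax (Suc m) (insert_min p \<sigma>) - 2) * ?W (Suc m) (insert_min p \<sigma>))"
    by (subst sum.cartesian_product[symmetric]) (rule sum.swap)
  also have "\<dots> = (\<Sum>\<sigma>\<in>perms m. fps_deriv (\<alpha> ^ (lmax m \<sigma> + rmax m \<sigma> - 2) * ?W m \<sigma>)
      + \<alpha> * (a + d) * (\<alpha> ^ (lmax m \<sigma> + rmax m \<sigma> - 2) * ?W m \<sigma>))"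
  proof (rule sum.cong[OF refl])
    fix \<sigma> assume \<sigma>: "\<sigma> \<in> perms m"
    define e where "e = lmax m \<sigma> + rmax m \<sigma> - 2"
    define F where "F p = \<alpha> ^ (lmax (Suc m) (insert_min p \<sigma>) + rmax (Suc m) (insert_min p \<sigma>) - 2) * ?W (Suc m) (insert_min p \<sigma>)" for p
    have e: "lmax m \<sigma> + rmax m \<sigma> = e + 2"
      using lmax_pos[OF m, of \<sigma>] rmax_pos[OF m, of \<sigma>] by (simp add: e_def)
    have "F 0 = \<alpha> * a * (\<alpha> ^ e * ?W m \<sigma>)" "F m = \<alpha> * d * (\<alpha> ^ e * ?W m \<sigma>)"
      using \<sigma> m e by (simp_all add: F_def lmax_insert_min rmax_insert_min word_prod_insert_front
          word_prod_insert_back algebra_simps)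
    moreover have "(\<Sum>p\<in>{1..<m}. F p) = \<alpha> ^ e * fps_deriv (?W m \<sigma>)"
    proof -
      have "(\<Sum>p\<in>{1..<m}. F p) = (\<Sum>p\<in>{1..<m}. \<alpha> ^ e * ?W (Suc m) (insert_min p \<sigma>))"
        using \<sigma> m e by (intro sum.cong) (simp_all add: F_def lmax_insert_min rmax_insert_min)
      then show ?thesis
        using sum_word_prod_insert_inside[OF \<sigma> m deriv(1-5)] by (simp add: sum_distrib_left[symmetric])
    qed
    moreover have "(\<Sum>p\<in>{0..m}. F p) = F 0 + F m + (\<Sum>p\<in>{1..<m}. F p)"
    proof -
      have "{0..m} = insert 0 (insert m {1..<m})" using m by auto
      then show ?thesis using m by (simp add: add.assoc)
    qed
    moreover have "fps_deriv (\<alpha> ^ e) = 0"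
      using deriv(6) by (simp add: fps_deriv_power')
    ultimately show "(\<Sum>p\<in>{0..m}. F p) = fps_deriv (\<alpha> ^ e * ?W m \<sigma>) + \<alpha> * (a + d) * (\<alpha> ^ e * ?W m \<sigma>)"
      by (simp add: algebra_simps)
  qed
  also have "\<dots> = fps_deriv (word_sum a a' d d' w \<alpha> n) + \<alpha> * (a + d) * word_sum a a' d d' w \<alpha> n"
    by (simp add: word_sum_def m_def sum.distrib fps_deriv_sum sum_distrib_left)
  finally show ?thesis .
qed

section \<open>Inserting the smallest letter into a cycle\<close>

text \<open>
The arguments \<open>rise\<close> and \<open>fall\<close> stand for \<open>inv \<sigma> i < i\<close> and \<open>\<sigma> i < i\<close>. Neither holds at a fixed
point, which therefore needs a flag to distinguish it from a cyclic valley. Cyclic peaks have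
weight \<open>1\<close>, being as numerous as cyclic valleys.
\<close>

definition cycle_factor :: "'r::comm_ring_1 \<Rightarrow> 'r \<Rightarrow> 'r \<Rightarrow> 'r \<Rightarrow> bool \<Rightarrow> bool \<Rightarrow> bool \<Rightarrow> 'r" where
  "cycle_factor f b c w fixed rise fall =
     (if fixed then f else if rise then if fall then 1 else b else if fall then c else w)"

text \<open>
The letters may form any finite set \<open>S\<close>, so a new smallest letter can be added without renaming the
old ones.
\<close>

definition cycle_prod :: "'r::comm_ring_1 \<Rightarrow> 'r \<Rightarrow> 'r \<Rightarrow> 'r \<Rightarrow> nat set \<Rightarrow> (nat \<Rightarrow> nat) \<Rightarrow> 'r" where
  "cycle_prod f b c w S \<sigma> = (\<Prod>i\<in>S. cycle_factor f b c w (\<sigma> i = i) (inv \<sigma> i < i) (\<sigma> i < i))"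

definition cycle_sum :: "'r::comm_ring_1 \<Rightarrow> 'r \<Rightarrow> 'r \<Rightarrow> 'r \<Rightarrow> 'r \<Rightarrow> nat set \<Rightarrow> 'r" where
  "cycle_sum f b c w \<beta> S =
     (\<Sum>\<sigma> | \<sigma> permutes S. \<beta> ^ card (orbit \<sigma> ` S) * cycle_prod f b c w S \<sigma>)"

lemma orbit_self:
  assumes "finite S" "\<sigma> permutes S" shows "x \<in> orbit \<sigma> x"
proof -
  have "permutation \<sigma>" unfolding permutation_permutes using assms by blast
  then show ?thesis by (rule permutation_self_in_orbit)
qed

lemma orbit_eq:
  assumes "finite S" "\<sigma> permutes S" "y \<in> orbit \<sigma> x"
  shows "orbit \<sigma> y = orbit \<sigma> x"
  using assms orbit_self[OF assms(1,2)] by (meson orbit_swap orbit_trans subsetI subset_antisym)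

text \<open>
The permutation \<open>transpose a b \<circ> q\<close> inserts \<open>a\<close> into the cycle of \<open>b\<close>, immediately before \<open>b\<close>;
hence no cycle of \<open>q\<close> is split or merged.
\<close>

lemma orbit_insert_before:
  assumes "finite S" "q permutes S" "a \<notin> S" "b \<in> S" "x \<in> S"
  shows "orbit (transpose a b \<circ> q) x - {a} = orbit q x"
proof -
  let ?t = "transpose a b \<circ> q"
  have qS: "q y \<in> S \<longleftrightarrow> y \<in> S" for y using assms(2) by (rule permutes_in_image)
  have qa: "q a = a" using assms(2,3) by (auto simp: permutes_def)
  have sub: "orbit q x \<subseteq> S" using assms(2,5) by (rule permutes_orbit_subset)
  have step: "q y \<in> orbit ?t x" if "y = x \<or> y \<in> orbit ?t x" "y \<in> S" for y
  proof (cases "q y = b")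
    case True
    have "?t y \<in> orbit ?t x" using that(1) by (auto intro: orbit.intros simp del: comp_apply)
    then have "a \<in> orbit ?t x" using True by simp
    then have "?t a \<in> orbit ?t x" by (rule orbit.step)
    then show ?thesis using qa True by simp
  next
    case False
    have "?t y \<in> orbit ?t x" using that(1) by (auto intro: orbit.intros simp del: comp_apply)
    moreover have "q y \<noteq> a" using qS[of y] that(2) assms(3) by auto
    ultimately show ?thesis using False by (simp add: transpose_def)
  qed
  have ext: "y \<in> orbit ?t x" if "y \<in> orbit q x" for y
    using that
  proof induction
    case base
    then show ?case using step assms(5) by blast
  next
    case (step y)
    then show ?case using \<open>\<And>y. y = x \<or> y \<in> orbit ?t x \<Longrightarrow> y \<in> S \<Longrightarrow> q y \<in> orbit ?t x\<close> sub by blast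
  qed
  \<comment> \<open>The induction can pass through \<open>a\<close>, so it must record that \<open>b\<close>, the image of \<open>a\<close>, is on the
    orbit then.\<close>
  have contr: "(if y = a then b \<in> orbit q x else y \<in> orbit q x)" if "y \<in> orbit ?t x" for y
    using that
  proof induction
    case base
    then show ?case using qS[of x] assms by (auto simp: transpose_def intro: orbit.base)
  next
    case (step y)
    have "y \<in> S" if "y \<noteq> a" using step that sub by auto
    then show ?case
      using step qS[of y] qa assms(3,4) by (auto simp: transpose_def split: if_splits intro: orbit.step dest: orbit.step)
  qed
  show ?thesis
  proof (intro equalityI subsetI)
    fix y assume "y \<in> orbit ?t x - {a}"
    then show "y \<in> orbit q x" using contr[of y] by simp
  next
    fix y assume "y \<in> orbit q x"
    then show "y \<in> orbit ?t x - {a}" using ext[of y] sub assms(3) by blast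
  qed
qed

lemma card_orbits_insert_before:
  assumes "finite S" "q permutes S" "a \<notin> S" "b \<in> S"
  shows "card (orbit (transpose a b \<circ> q) ` insert a S) = card (orbit q ` S)"
proof -
  let ?t = "transpose a b \<circ> q"
  have t: "?t permutes insert a S"
    using assms by (intro permutes_compose permutes_swap_id permutes_imp_permutes_insert) auto
  have fin: "finite (insert a S)" using assms by simp
  have qa: "q a = a" using assms(2,3) by (auto simp: permutes_def)
  have "b \<in> orbit ?t a" using orbit.base[of ?t a] qa by simp
  then have "orbit ?t a = orbit ?t b" using orbit_eq[OF fin t] by simp
  then have "orbit ?t ` insert a S = orbit ?t ` S" using assms(4) by auto
  moreover have "inj_on (\<lambda>C. C - {a}) (orbit ?t ` S)"
  proof (rule inj_onI, elim imageE)
    fix C C' x y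
    assume *: "C - {a} = C' - {a}" "C = orbit ?t x" "x \<in> S" "C' = orbit ?t y" "y \<in> S"
    have "x \<in> C'" using orbit_self[OF fin t, of x] * assms(3) by auto
    then show "C = C'" using orbit_eq[OF fin t, of x y] * by simp
  qed
  moreover have "(\<lambda>C. C - {a}) ` orbit ?t ` S = orbit q ` S"
    using orbit_insert_before[OF assms] by (simp add: image_image)
  ultimately show ?thesis using card_image by metis
qed

lemma card_orbits_insert_fixed:
  assumes "finite S" "q permutes S" "a \<notin> S"
  shows "card (orbit q ` insert a S) = Suc (card (orbit q ` S))"
proof -
  have "a \<notin> orbit q x" if "x \<in> S" for x
    using permutes_orbit_subset[OF assms(2) that] assms(3) by auto
  then have "orbit q a \<notin> orbit q ` S"
    using orbit_self[OF assms(1,2), of a] by auto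
  then show ?thesis using assms(1) by simp
qed

lemma cycle_prod_insert_fixed:
  assumes "finite S" "q permutes S" "a \<notin> S"
  shows "cycle_prod f b c w (insert a S) q = f * cycle_prod f b c w S q"
proof -
  have "q a = a" using assms(2,3) by (auto simp: permutes_def)
  then show ?thesis using assms by (simp add: cycle_prod_def cycle_factor_def)
qed

text \<open>
Let \<open>p = inv q s\<close>, so that the insertion turns \<open>p \<mapsto> s\<close> into \<open>p \<mapsto> a \<mapsto> s\<close>. As for words, \<open>a\<close> is a
valley and only the smaller of \<open>p\<close> and \<open>s\<close> changes its type. If \<open>p = s\<close> is a fixed point, it becomes
a peak, whose factor \<open>1\<close> is left out of the first case.
\<close>

lemma cycle_prod_insert_before:
  assumes "finite S" "q permutes S" "\<forall>x\<in>S. a < x" "s \<in> S"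
  shows "cycle_prod f b c w (insert a S) (transpose a s \<circ> q) = w *
    (if q s = s then \<Prod>i\<in>S - {s}. cycle_factor f b c w (q i = i) (inv q i < i) (q i < i)
     else if inv q s < s
     then cycle_factor f b c w False (inv q (inv q s) < inv q s) True *
        (\<Prod>i\<in>S - {inv q s}. cycle_factor f b c w (q i = i) (inv q i < i) (q i < i))
     else cycle_factor f b c w False True (q s < s) *
        (\<Prod>i\<in>S - {s}. cycle_factor f b c w (q i = i) (inv q i < i) (q i < i)))"
proof -
  let ?t = "transpose a s \<circ> q"
  define p where "p = inv q s"
  have aS: "a \<notin> S" using assms(3) by auto
  have as: "a < s" using assms by auto
  have qa: "q a = a" using assms(2) aS by (auto simp: permutes_def)
  have inva: "inv q a = a" using permutes_inv_eq[OF assms(2)] qa by blast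
  have qp: "q p = s" unfolding p_def using permutes_inverses(1)[OF assms(2)] .
  have pS: "p \<in> S" unfolding p_def using permutes_in_image[OF permutes_inv[OF assms(2)]] assms(4) by blast
  have ap: "a < p" using pS assms(3) by auto
  have invt: "inv ?t = inv q \<circ> transpose a s"
    using o_inv_distrib[of "transpose a s" q] permutes_bij[OF assms(2)] by simp
  have qeq: "q i = s \<longleftrightarrow> i = p" for i
    using qp permutes_inj[OF assms(2)] by (metis injD)
  have inveq: "inv q i = i \<longleftrightarrow> q i = i" for i
    using permutes_inv_eq[OF assms(2)] by blast
  let ?c = "\<lambda>\<sigma> i. cycle_factor f b c w (\<sigma> i = i) (inv \<sigma> i < i) (\<sigma> i < i)"
  have new: "?c ?t a = w"
    using as ap qa invt by (simp add: cycle_factor_def p_def)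
  have old: "?c ?t i = cycle_factor f b c w (i \<noteq> p \<and> q i = i) (i = s \<or> inv q i < i) (i = p \<or> q i < i)"
    if "i \<in> S" for i
  proof -
    have "a < i" "i \<noteq> a" using that assms(3) by auto
    have "q i \<in> S" using that assms(2) by (simp add: permutes_in_image)
    then have "q i \<noteq> a" using aS by auto
    have "?t i = (if i = p then a else q i)"
      using qeq[of i] \<open>q i \<noteq> a\<close> by (simp add: transpose_def)
    moreover have "inv ?t i = (if i = s then a else inv q i)"
      using \<open>i \<noteq> a\<close> inva by (simp add: invt transpose_def)
    ultimately show ?thesis using \<open>a < i\<close> by auto
  qed
  define k where "k = (if p < s then p else s)"
  have kS: "k \<in> S" using pS assms(4) by (simp add: k_def)
  have "(\<Prod>i\<in>S. ?c ?t i) = ?c ?t k * (\<Prod>i\<in>S - {k}. ?c q i)"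
  proof (rule prod_eq_except[OF assms(1) kS])
    fix i assume i: "i \<in> S" "i \<noteq> k"
    have "i \<noteq> p \<and> q i = i \<longleftrightarrow> q i = i" "i = s \<or> inv q i < i \<longleftrightarrow> inv q i < i" "i = p \<or> q i < i \<longleftrightarrow> q i < i"
      using i qp by (auto simp: k_def p_def split: if_splits)
    then show "?c ?t i = ?c q i" using old[OF i(1)] by simp
  qed
  moreover have "?c ?t k = (if q s = s then 1
      else if p < s then cycle_factor f b c w False (inv q p < p) True
      else cycle_factor f b c w False True (q s < s))"
    unfolding old[OF kS] using qeq[of s] by (auto simp: k_def cycle_factor_def)
  ultimately show ?thesis
    using aS assms(1) new qeq[of s] unfolding cycle_prod_def p_def[symmetric] by (auto simp: k_def)
qed

text \<open>
The summands belong to the arcs \<open>i \<mapsto> q i\<close> and \<open>inv q i \<mapsto> i\<close>, each present if \<open>i\<close> is the smaller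
end; the loop at a fixed point is counted in the second one.
\<close>

lemma deriv_cycle_factor:
  fixes f b c w :: "'a::comm_ring_1 fps" and q :: "nat \<Rightarrow> nat"
  assumes "q permutes S"
    and "fps_deriv f = w" "fps_deriv b = w" "fps_deriv c = w" "fps_deriv w = w * (b + c)"
  shows "fps_deriv (cycle_factor f b c w (q i = i) (inv q i < i) (q i < i)) =
    (if i < q i then w * cycle_factor f b c w False (inv q i < i) True else 0) +
    (if q i = i then w else if inv q i < i then 0 else w * cycle_factor f b c w False True (q i < i))"
proof -
  have "inv q i = i \<longleftrightarrow> q i = i"
    using permutes_inv_eq[OF assms(1)] by blast
  then show ?thesis
    using assms(2-) by (cases "q i" i rule: linorder_cases) (auto simp: cycle_factor_def algebra_simps)
qed

text \<open>
The Leibniz rule again, with each arc \<open>inv q s \<mapsto> s\<close> charged to its smaller end.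
\<close>

lemma sum_cycle_prod_insert_before:
  fixes f b c w :: "'a::comm_ring_1 fps"
  assumes S: "finite S" "q permutes S" "\<forall>x\<in>S. a < x"
    and deriv: "fps_deriv f = w" "fps_deriv b = w" "fps_deriv c = w" "fps_deriv w = w * (b + c)"
  shows "(\<Sum>s\<in>S. cycle_prod f b c w (insert a S) (transpose a s \<circ> q)) = fps_deriv (cycle_prod f b c w S q)"
proof -
  define P where "P k = (\<Prod>i\<in>S - {k}. cycle_factor f b c w (q i = i) (inv q i < i) (q i < i))" for k
  define g where "g p = w * cycle_factor f b c w False (inv q p < p) True * P p" for p
  define h where "h s = w * cycle_factor f b c w False True (q s < s) * P s" for s
  have invq: "inv q permutes S" using S(2) by (rule permutes_inv)
  have qinv: "q (inv q s) = s" for s using permutes_inverses(1)[OF S(2)] .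
  have inveq: "inv q i = i \<longleftrightarrow> q i = i" for i
    using permutes_inv_eq[OF S(2)] by blast
  have "(\<Sum>s\<in>S. cycle_prod f b c w (insert a S) (transpose a s \<circ> q))
      = (\<Sum>s\<in>S. (if inv q s < q (inv q s) then g (inv q s) else 0) +
          (if q s = s then w * P s else if inv q s < s then 0 else h s))"
  proof (intro sum.cong refl)
    fix s assume "s \<in> S"
    then show "cycle_prod f b c w (insert a S) (transpose a s \<circ> q) =
        (if inv q s < q (inv q s) then g (inv q s) else 0) +
        (if q s = s then w * P s else if inv q s < s then 0 else h s)"
      unfolding qinv cycle_prod_insert_before[OF S \<open>s \<in> S\<close>]
      using inveq[of s] by (auto simp: P_def g_def h_def mult.assoc)
  qed
  also have "\<dots> = (\<Sum>s\<in>S. if inv q s < q (inv q s) then g (inv q s) else 0) +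
          (\<Sum>s\<in>S. if q s = s then w * P s else if inv q s < s then 0 else h s)"
    by (rule sum.distrib)
  also have "(\<Sum>s\<in>S. if inv q s < q (inv q s) then g (inv q s) else 0) = (\<Sum>p\<in>S. if p < q p then g p else 0)"
    using sum.permute[OF invq, of "\<lambda>p. if p < q p then g p else 0"] by (simp add: o_def)
  also have "(\<Sum>p\<in>S. if p < q p then g p else 0) +
          (\<Sum>s\<in>S. if q s = s then w * P s else if inv q s < s then 0 else h s)
      = (\<Sum>k\<in>S. fps_deriv (cycle_factor f b c w (q k = k) (inv q k < k) (q k < k)) * P k)"
    unfolding sum.distrib[symmetric] deriv_cycle_factor[OF S(2) deriv]
    by (intro sum.cong refl) (auto simp: g_def h_def algebra_simps)
  also have "\<dots> = fps_deriv (cycle_prod f b c w S q)"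
    unfolding cycle_prod_def P_def by (rule fps_deriv_prod[symmetric, OF S(1)])
  finally show ?thesis .
qed

lemma cycle_sum_empty: "cycle_sum f b c w \<beta> {} = 1"
  by (simp add: cycle_sum_def cycle_prod_def)

text \<open>
If \<open>a\<close> becomes a fixed point, it contributes a new cycle, hence the term \<open>\<beta> * f\<close>; otherwise it is
inserted before some \<open>s \<in> S\<close>.
\<close>

lemma cycle_sum_insert:
  fixes f b c w \<beta> :: "'a::comm_ring_1 fps"
  assumes S: "finite S" "\<forall>x\<in>S. a < x"
    and deriv: "fps_deriv f = w" "fps_deriv b = w" "fps_deriv c = w" "fps_deriv w = w * (b + c)"
      "fps_deriv \<beta> = 0"
  shows "cycle_sum f b c w \<beta> (insert a S) =
    fps_deriv (cycle_sum f b c w \<beta> S) + \<beta> * f * cycle_sum f b c w \<beta> S"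
proof -
  let ?W = "\<lambda>S \<sigma>. \<beta> ^ card (orbit \<sigma> ` S) * cycle_prod f b c w S \<sigma>"
  have aS: "a \<notin> S" using S(2) by auto
  have "cycle_sum f b c w \<beta> (insert a S) =
      (\<Sum>s\<in>insert a S. \<Sum>q | q permutes S. ?W (insert a S) (transpose a s \<circ> q))"
    unfolding cycle_sum_def by (rule sum_over_permutations_insert[OF S(1) aS])
  also have "\<dots> = (\<Sum>q | q permutes S. \<Sum>s\<in>insert a S. ?W (insert a S) (transpose a s \<circ> q))"
    by (rule sum.swap)
  also have "\<dots> = (\<Sum>q | q permutes S. fps_deriv (?W S q) + \<beta> * f * ?W S q)"
  proof (rule sum.cong[OF refl])
    fix q assume "q \<in> {q. q permutes S}"
    then have q: "q permutes S" by simp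
    have "(\<Sum>s\<in>S. ?W (insert a S) (transpose a s \<circ> q))
        = (\<Sum>s\<in>S. \<beta> ^ card (orbit q ` S) * cycle_prod f b c w (insert a S) (transpose a s \<circ> q))"
      by (intro sum.cong refl) (simp only: card_orbits_insert_before[OF S(1) q aS])
    also have "\<dots> = \<beta> ^ card (orbit q ` S) * fps_deriv (cycle_prod f b c w S q)"
      unfolding sum_distrib_left[symmetric] sum_cycle_prod_insert_before[OF S(1) q S(2) deriv(1-4)] ..
    also have "\<dots> = fps_deriv (?W S q)"
      using deriv(5) by (simp add: fps_deriv_power')
    finally have "(\<Sum>s\<in>S. ?W (insert a S) (transpose a s \<circ> q)) = fps_deriv (?W S q)" .
    moreover have "?W (insert a S) (transpose a a \<circ> q) = \<beta> * f * ?W S q"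
    proof -
      have "transpose a a \<circ> q = q" by simp
      then show ?thesis
        unfolding card_orbits_insert_fixed[OF S(1) q aS] cycle_prod_insert_fixed[OF S(1) q aS]
          \<open>transpose a a \<circ> q = q\<close> by (simp add: algebra_simps)
    qed
    ultimately show "(\<Sum>s\<in>insert a S. ?W (insert a S) (transpose a s \<circ> q)) = fps_deriv (?W S q) + \<beta> * f * ?W S q"
      using S(1) aS by (simp add: add.commute)
  qed
  also have "\<dots> = fps_deriv (cycle_sum f b c w \<beta> S) + \<beta> * f * cycle_sum f b c w \<beta> S"
    by (simp add: cycle_sum_def sum.distrib fps_deriv_sum sum_distrib_left)
  finally show ?thesis .
qed

section \<open>Integrating the derivation\<close>

text \<open>
The coefficients of the power series solution of \<open>W' = w\<^sub>0 + s * W + W\<^sup>2\<close> with \<open>W(0) = 0\<close>.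
\<close>

fun riccati_coeff :: "'a::field_char_0 \<Rightarrow> 'a \<Rightarrow> nat \<Rightarrow> 'a" where
  "riccati_coeff w\<^sub>0 s 0 = 0"
| "riccati_coeff w\<^sub>0 s (Suc k) =
     ((if k = 0 then w\<^sub>0 else 0) + s * riccati_coeff w\<^sub>0 s k
        + (\<Sum>i\<in>{0..k}. riccati_coeff w\<^sub>0 s i * riccati_coeff w\<^sub>0 s (k - i))) / of_nat (Suc k)"

text \<open>
The recurrences ask for power series \<open>a\<close>, \<open>a'\<close>, \<open>d\<close>, \<open>d'\<close>, \<open>w\<close> with prescribed constant terms, of
which the first four have derivative \<open>w\<close>, and \<open>w' = w * (a' + d')\<close>. The first four are
then constants plus the same series \<open>W\<close>, the integral of \<open>w\<close>, so with \<open>s\<close> the constant term of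
\<open>a' + d'\<close> the system becomes \<open>W'' = W' * (s + 2 * W)\<close>. Its first integral is the Riccati equation
\<open>W' = w\<^sub>0 + s * W + W\<^sup>2\<close>.
\<close>

lemma flow_exists:
  fixes w\<^sub>0 s :: "'a::field_char_0"
  obtains W w :: "'a fps" where "fps_nth W 0 = 0" "fps_nth w 0 = w\<^sub>0"
    "fps_deriv W = w" "fps_deriv w = w * (fps_const s + 2 * W)"
proof -
  define W where "W = Abs_fps (riccati_coeff w\<^sub>0 s)"
  have W': "fps_deriv W = fps_const w\<^sub>0 + fps_const s * W + W * W"
  proof (rule fps_ext)
    fix k
    have "fps_nth (fps_deriv W) k = of_nat (Suc k) * riccati_coeff w\<^sub>0 s (Suc k)"
      by (simp add: W_def)
    also have "\<dots> = (if k = 0 then w\<^sub>0 else 0) + s * riccati_coeff w\<^sub>0 s k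
        + (\<Sum>i\<in>{0..k}. riccati_coeff w\<^sub>0 s i * riccati_coeff w\<^sub>0 s (k - i))"
      by (simp del: of_nat_Suc)
    also have "\<dots> = fps_nth (fps_const w\<^sub>0 + fps_const s * W + W * W) k"
      by (simp add: W_def fps_mult_nth[of "Abs_fps _" "Abs_fps _"])
    finally show "fps_nth (fps_deriv W) k = \<dots>" .
  qed
  have W0: "fps_nth W 0 = 0" by (simp add: W_def)
  have "fps_deriv (fps_deriv W) = fps_deriv W * (fps_const s + 2 * W)"
    by (subst W') (simp add: algebra_simps)
  moreover have "fps_nth (fps_deriv W) 0 = w\<^sub>0"
    unfolding W' by (simp add: W0)
  ultimately show ?thesis using that W0 by blast
qed

lemma fps_nth_prod_0: "fps_nth (\<Prod>i\<in>S. c i) 0 = (\<Prod>i\<in>S. fps_nth (c i :: 'a::comm_ring_1 fps) 0)"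
  by (induction S rule: infinite_finite_induct) auto

lemma word_sum_nth_0:
  fixes a a' d d' w \<alpha> :: "'a::comm_ring_1 fps"
  shows "fps_nth (word_sum a a' d d' w \<alpha> n) 0 =
    word_sum (fps_nth a 0) (fps_nth a' 0) (fps_nth d 0) (fps_nth d' 0) (fps_nth w 0) (fps_nth \<alpha> 0) n"
  by (simp add: word_sum_def word_prod_def word_factor_def letter_factor_def fps_sum_nth
      fps_nth_prod_0 fps_nth_power_0 if_distrib[of "\<lambda>x. fps_nth x 0"] cong: if_cong)

lemma cycle_sum_nth_0:
  fixes f b c w \<beta> :: "'a::comm_ring_1 fps"
  shows "fps_nth (cycle_sum f b c w \<beta> S) 0 =
    cycle_sum (fps_nth f 0) (fps_nth b 0) (fps_nth c 0) (fps_nth w 0) (fps_nth \<beta> 0) S"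
  by (simp add: cycle_sum_def cycle_prod_def cycle_factor_def fps_sum_nth
      fps_nth_prod_0 fps_nth_power_0 if_distrib[of "\<lambda>x. fps_nth x 0"] cong: if_cong)

text \<open>
The given scalars are extended to power series along which \<open>fps_deriv\<close> acts as the derivation of both
recurrences. The hypotheses make the two series \<open>w\<close> agree, as they depend only on \<open>a' + d'\<close> and
\<open>b + c\<close>, and give \<open>\<alpha> * (a + d) = 2 * \<alpha> * f\<close>. So the two sums obey the same recurrence as power
series, and their constant terms are the two sides of the claim.
\<close>

lemma word_sum_eq_cycle_sum:
  fixes a a' d d' f b c w \<alpha> :: "'a::field_char_0"
  assumes "a + d = 2 * f" "a' + d' = b + c" "finite S"
  shows "word_sum a a' d d' w \<alpha> (card S) = cycle_sum f b c w (2 * \<alpha>) S"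
proof -
  obtain W v where flow: "fps_nth W 0 = 0" "fps_nth v 0 = w"
    "fps_deriv W = v" "fps_deriv v = v * (fps_const (a' + d') + 2 * W)"
    by (rule flow_exists)
  define lift where "lift x = fps_const x + W" for x
  have lift: "fps_deriv (lift x) = v" "fps_nth (lift x) 0 = x" for x
    by (simp_all add: lift_def flow)
  have "fps_deriv v = v * (lift a' + lift d')"
    by (simp add: flow(4) lift_def algebra_simps flip: fps_const_add)
  moreover have "fps_deriv v = v * (lift b + lift c)"
    unfolding flow(4) assms(2) by (simp add: lift_def algebra_simps flip: fps_const_add)
  moreover have "fps_const \<alpha> * (lift a + lift d) = fps_const (2 * \<alpha>) * lift f"
  proof -
    have "lift a + lift d = fps_const (a + d) + 2 * W"
      by (simp add: lift_def flip: fps_const_add)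
    also have "\<dots> = 2 * lift f"
      unfolding assms(1) by (simp add: lift_def fps_numeral_fps_const algebra_simps)
    finally show ?thesis by (simp add: fps_numeral_fps_const algebra_simps flip: fps_const_mult)
  qed
  ultimately have step:
    "word_sum (lift a) (lift a') (lift d) (lift d') v (fps_const \<alpha>) (Suc k) =
      fps_deriv (word_sum (lift a) (lift a') (lift d) (lift d') v (fps_const \<alpha>) k)
      + fps_const (2 * \<alpha>) * lift f * word_sum (lift a) (lift a') (lift d) (lift d') v (fps_const \<alpha>) k"
    "finite S \<Longrightarrow> \<forall>x\<in>S. m < x \<Longrightarrow>
     cycle_sum (lift f) (lift b) (lift c) v (fps_const (2 * \<alpha>)) (insert m S) =
      fps_deriv (cycle_sum (lift f) (lift b) (lift c) v (fps_const (2 * \<alpha>)) S)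
      + fps_const (2 * \<alpha>) * lift f * cycle_sum (lift f) (lift b) (lift c) v (fps_const (2 * \<alpha>)) S"
    for k m S
    by (simp_all add: word_sum_Suc cycle_sum_insert lift)
  have "word_sum (lift a) (lift a') (lift d) (lift d') v (fps_const \<alpha>) (card S) =
      cycle_sum (lift f) (lift b) (lift c) v (fps_const (2 * \<alpha>)) S"
    using assms(3)
  proof (induction rule: finite_linorder_min_induct)
    case empty
    show ?case by (simp add: word_sum_0 cycle_sum_empty)
  next
    case (insert m S)
    then have "m \<notin> S" by auto
    with insert show ?case by (simp add: step)
  qed
  then have "fps_nth (word_sum (lift a) (lift a') (lift d) (lift d') v (fps_const \<alpha>) (card S)) 0 =
      fps_nth (cycle_sum (lift f) (lift b) (lift c) v (fps_const (2 * \<alpha>)) S) 0"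
    by (rule arg_cong)
  then show ?thesis
    unfolding word_sum_nth_0 cycle_sum_nth_0 by (simp add: lift flow(2))
qed

text \<open>
Both sides agree with one cyclic sum. This is the source of \<open>\<gamma>\<close>-positivity: the weights of ascents
can be moved to descents and back, as long as their sums are kept.
\<close>

lemma word_sum_cong:
  fixes a a' d d' w \<alpha> :: "'a::field_char_0"
  assumes "a + d = b + e" "a' + d' = b' + e'"
  shows "word_sum a a' d d' w \<alpha> n = word_sum b b' e e' w \<alpha> n"
  using word_sum_eq_cycle_sum[of a d "(a + d) / 2" a' d' 0 "a' + d'" "{1..n}"]
    word_sum_eq_cycle_sum[of b e "(a + d) / 2" b' e' 0 "a' + d'" "{1..n}"] assms
  by simp

section \<open>Reading off the statistics\<close>

lemma card_filter_split:
  assumes "finite A"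
  shows "card {i \<in> A. P i} = card {i \<in> A. P i \<and> Q i} + card {i \<in> A. P i \<and> \<not> Q i}"
proof -
  have "{i \<in> A. P i} = {i \<in> A. P i \<and> Q i} \<union> {i \<in> A. P i \<and> \<not> Q i}" by auto
  moreover have "card ({i \<in> A. P i \<and> Q i} \<union> {i \<in> A. P i \<and> \<not> Q i}) =
      card {i \<in> A. P i \<and> Q i} + card {i \<in> A. P i \<and> \<not> Q i}"
    using assms by (intro card_Un_disjoint) auto
  ultimately show ?thesis by simp
qed

lemma card_filter_complement:
  assumes "finite A"
  shows "card {i \<in> A. P i} + card {i \<in> A. \<not> P i} = card A"
  using card_filter_split[OF assms, of "\<lambda>_. True" P] by simp

lemma prod_if_const:
  assumes "finite A"
  shows "(\<Prod>i\<in>A. if P i then c else 1) = (c::'r::comm_monoid_mult) ^ card {i \<in> A. P i}"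
  using assms by (simp add: prod.inter_filter[symmetric])

definition valleys :: "nat \<Rightarrow> (nat \<Rightarrow> nat) \<Rightarrow> nat" where
  "valleys m \<sigma> = card {i \<in> {1..m}. \<not> rises_to m \<sigma> i \<and> \<not> falls_from m \<sigma> i}"

lemma letter_neq:
  assumes "\<sigma> \<in> perms m" "1 \<le> i" "i \<le> m"
  shows "letter m \<sigma> (i - 1) \<noteq> letter m \<sigma> i" "letter m \<sigma> (i + 1) \<noteq> letter m \<sigma> i"
proof -
  have "\<sigma> (i - 1) \<noteq> \<sigma> i" "\<sigma> (i + 1) \<noteq> \<sigma> i" "\<sigma> i \<noteq> 0"
    using perms_inj[OF assms(1)] perms_value(1)[OF assms] assms(2) by (auto simp: inj_eq)
  then show "letter m \<sigma> (i - 1) \<noteq> letter m \<sigma> i" "letter m \<sigma> (i + 1) \<noteq> letter m \<sigma> i"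
    using assms by (auto simp: letter_def)
qed

lemma letter_types:
  assumes "\<sigma> \<in> perms m" "1 \<le> i" "i \<le> m"
  shows "is_peak m \<sigma> i \<longleftrightarrow> rises_to m \<sigma> i \<and> falls_from m \<sigma> i"
    and "is_double_ascent m \<sigma> i \<longleftrightarrow> rises_to m \<sigma> i \<and> \<not> falls_from m \<sigma> i"
    and "is_double_descent m \<sigma> i \<longleftrightarrow> \<not> rises_to m \<sigma> i \<and> falls_from m \<sigma> i"
  using letter_neq[OF assms]
  by (auto simp: is_peak_def is_double_ascent_def is_double_descent_def rises_to_def falls_from_def)

text \<open>
Positions \<open>i\<close> from which the word does not fall are the ascents, and positions to which it does not
rise are the descents shifted by one. Comparing \<open>asc + des = n\<close> with the classification of all
\<open>n + 1\<close> letters shows that there is one more peak than valleys.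
\<close>

lemma word_counts:
  assumes \<sigma>: "\<sigma> \<in> perms (Suc n)"
  shows "asc (Suc n) \<sigma> = da (Suc n) \<sigma> + valleys (Suc n) \<sigma>"
    and "des (Suc n) \<sigma> = dd (Suc n) \<sigma> + valleys (Suc n) \<sigma>"
    and "da (Suc n) \<sigma> + dd (Suc n) \<sigma> + 2 * valleys (Suc n) \<sigma> = n"
    and "pk (Suc n) \<sigma> = Suc (valleys (Suc n) \<sigma>)"
proof -
  let ?m = "Suc n"
  let ?U = "rises_to ?m \<sigma>" and ?V = "falls_from ?m \<sigma>"
  have types: "da ?m \<sigma> = card {i \<in> {1..?m}. ?U i \<and> \<not> ?V i}"
    "dd ?m \<sigma> = card {i \<in> {1..?m}. \<not> ?U i \<and> ?V i}" "pk ?m \<sigma> = card {i \<in> {1..?m}. ?U i \<and> ?V i}"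
    unfolding da_def dd_def pk_def
    by (intro arg_cong[where f = card] Collect_cong; auto simp: letter_types[OF \<sigma>])+
  have rise: "card {i \<in> {1..?m}. ?U i} = pk ?m \<sigma> + da ?m \<sigma>"
    and no_rise: "card {i \<in> {1..?m}. \<not> ?U i} = dd ?m \<sigma> + valleys ?m \<sigma>"
    unfolding types valleys_def by (intro card_filter_split finite_atLeastAtMost)+
  have total: "card {i \<in> {1..?m}. ?U i} + card {i \<in> {1..?m}. \<not> ?U i} = ?m"
    using card_filter_complement[of "{1..?m}" ?U]
    by (simp only: finite_atLeastAtMost card_atLeastAtMost diff_Suc_1)
  have neq: "\<sigma> i \<noteq> \<sigma> (Suc i)" for i
    using perms_inj[OF \<sigma>] by (auto simp: inj_eq)
  have "{i \<in> {1..<?m}. \<sigma> i < \<sigma> (i + 1)} = {i \<in> {1..?m}. \<not> ?V i}"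
  proof (intro Collect_cong)
    fix i
    show "i \<in> {1..<?m} \<and> \<sigma> i < \<sigma> (i + 1) \<longleftrightarrow> i \<in> {1..?m} \<and> \<not> ?V i"
      using falls_from_last[OF \<sigma>] neq[of i]
      by (cases "i = ?m") (auto simp: falls_from_def letter_def)
  qed
  then have asc: "asc ?m \<sigma> = card {i \<in> {1..?m}. \<not> ?V i}"
    by (simp add: asc_def)
  also have "\<dots> = card {i \<in> {1..?m}. \<not> ?V i \<and> ?U i} + card {i \<in> {1..?m}. \<not> ?V i \<and> \<not> ?U i}"
    by (intro card_filter_split finite_atLeastAtMost)
  also have "\<dots> = da ?m \<sigma> + valleys ?m \<sigma>"
    unfolding types valleys_def by (simp add: conj_commute)
  finally show A: "asc ?m \<sigma> = da ?m \<sigma> + valleys ?m \<sigma>" .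
  have "Suc ` {i \<in> {1..<?m}. \<sigma> i > \<sigma> (i + 1)} = {i \<in> {1..?m}. \<not> ?U i}"
  proof (intro equalityI subsetI)
    fix i assume "i \<in> {i \<in> {1..?m}. \<not> ?U i}"
    moreover then have "i \<noteq> 1" using rises_to_1[OF \<sigma>] by auto
    ultimately show "i \<in> Suc ` {i \<in> {1..<?m}. \<sigma> i > \<sigma> (i + 1)}"
      using neq[of "i - 1"] by (cases i) (auto simp: rises_to_def letter_def split: if_splits)
  qed (auto simp: rises_to_def letter_def)
  then have "card {i \<in> {1..?m}. \<not> ?U i} = card {i \<in> {1..<?m}. \<sigma> i > \<sigma> (i + 1)}"
    by (metis (no_types, lifting) card_image inj_Suc inj_on_subset subset_UNIV)
  then show D: "des ?m \<sigma> = dd ?m \<sigma> + valleys ?m \<sigma>"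
    using no_rise by (simp add: des_def)
  have "{i \<in> {1..<?m}. \<not> \<sigma> i < \<sigma> (i + 1)} = {i \<in> {1..<?m}. \<sigma> i > \<sigma> (i + 1)}"
  proof (rule Collect_cong)
    fix i
    show "i \<in> {1..<?m} \<and> \<not> \<sigma> i < \<sigma> (i + 1) \<longleftrightarrow> i \<in> {1..<?m} \<and> \<sigma> i > \<sigma> (i + 1)"
      using neq[of i] by auto
  qed
  then have "asc ?m \<sigma> + des ?m \<sigma> = n"
    using card_filter_complement[of "{1..<?m}" "\<lambda>i. \<sigma> i < \<sigma> (i + 1)"]
    unfolding asc_def des_def by (simp only: finite_atLeastLessThan card_atLeastLessThan diff_Suc_1)
  then show "da ?m \<sigma> + dd ?m \<sigma> + 2 * valleys ?m \<sigma> = n"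
    using A D by simp
  then show "pk ?m \<sigma> = Suc (valleys ?m \<sigma>)"
    using rise no_rise total by simp
qed

lemma word_prod_statistics:
  assumes \<sigma>: "\<sigma> \<in> perms m"
  shows "word_prod a a' d d' w m \<sigma> =
    a ^ lmaxda m \<sigma> * a' ^ (da m \<sigma> - lmaxda m \<sigma>) * d ^ rmaxdd m \<sigma> * d' ^ (dd m \<sigma> - rmaxdd m \<sigma>)
      * w ^ valleys m \<sigma>"
proof -
  let ?L = "\<lambda>i. is_lr_max \<sigma> i \<and> is_double_ascent m \<sigma> i"
  let ?L' = "\<lambda>i. is_double_ascent m \<sigma> i \<and> \<not> is_lr_max \<sigma> i"
  let ?R = "\<lambda>i. is_rl_max m \<sigma> i \<and> is_double_descent m \<sigma> i"
  let ?R' = "\<lambda>i. is_double_descent m \<sigma> i \<and> \<not> is_rl_max m \<sigma> i"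
  let ?V = "\<lambda>i. \<not> rises_to m \<sigma> i \<and> \<not> falls_from m \<sigma> i"
  have "word_prod a a' d d' w m \<sigma> = (\<Prod>i\<in>{1..m}. (if ?L i then a else 1) * (if ?L' i then a' else 1)
      * (if ?R i then d else 1) * (if ?R' i then d' else 1) * (if ?V i then w else 1))"
    unfolding word_prod_def
    by (intro prod.cong refl) (auto simp: letter_types[OF \<sigma>] word_factor_def letter_factor_def)
  moreover have "card {i \<in> {1..m}. ?L' i} = da m \<sigma> - lmaxda m \<sigma>"
    unfolding da_def lmaxda_def
    by (subst card_filter_split[of _ _ "is_lr_max \<sigma>"]) (simp_all add: conj_commute)
  moreover have "card {i \<in> {1..m}. ?R' i} = dd m \<sigma> - rmaxdd m \<sigma>"
    unfolding dd_def rmaxdd_def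
    by (subst card_filter_split[of _ _ "is_rl_max m \<sigma>"]) (simp_all add: conj_commute)
  ultimately show ?thesis
    by (simp only: prod.distrib prod_if_const finite_atLeastAtMost lmaxda_def rmaxdd_def valleys_def)
qed

lemma lmaxda_le_da: "lmaxda m \<sigma> \<le> da m \<sigma>"
  unfolding lmaxda_def da_def by (intro card_mono) auto

lemma rmaxdd_le_dd: "rmaxdd m \<sigma> \<le> dd m \<sigma>"
  unfolding rmaxdd_def dd_def by (intro card_mono) auto

text \<open>
The permutation maps excedance positions onto excedance values, so both are equinumerous. Excedance
positions are double ascents and valleys, excedance values double ascents and peaks; hence there
are as many cyclic valleys as cyclic peaks.
\<close>

lemma cycle_counts:
  assumes \<sigma>: "\<sigma> \<in> perms n"
  shows "exc n \<sigma> = cda n \<sigma> + cpk n \<sigma>"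
    and "drops n \<sigma> = cdd n \<sigma> + cpk n \<sigma>"
    and "card {i \<in> {1..n}. i < \<sigma> i \<and> \<not> inv \<sigma> i < i} = cpk n \<sigma>"
proof -
  have p: "\<sigma> permutes {1..n}" using \<sigma> by (simp add: perms_def)
  have invs: "inv \<sigma> (\<sigma> i) = i" "\<sigma> (inv \<sigma> i) = i" for i
    using permutes_inverses[OF p] by auto
  have fix_iff: "inv \<sigma> i = i \<longleftrightarrow> \<sigma> i = i" for i
    using permutes_inv_eq[OF p] by blast
  have "\<sigma> ` {i \<in> {1..n}. i < \<sigma> i} = {i \<in> {1..n}. inv \<sigma> i < i}"
  proof (intro equalityI subsetI)
    fix i assume "i \<in> {i \<in> {1..n}. inv \<sigma> i < i}"
    then show "i \<in> \<sigma> ` {i \<in> {1..n}. i < \<sigma> i}"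
      using permutes_in_image[OF permutes_inv[OF p], of i] invs
      by (intro image_eqI[of _ _ "inv \<sigma> i"]) auto
  qed (use permutes_in_image[OF p] invs in auto)
  then have exc: "exc n \<sigma> = card {i \<in> {1..n}. inv \<sigma> i < i}"
    unfolding exc_def by (metis (no_types, lifting) card_image inj_on_subset permutes_inj[OF p] subset_UNIV)
  also have "\<dots> = card {i \<in> {1..n}. inv \<sigma> i < i \<and> \<sigma> i < i} + card {i \<in> {1..n}. inv \<sigma> i < i \<and> \<not> \<sigma> i < i}"
    by (intro card_filter_split finite_atLeastAtMost)
  also have "{i \<in> {1..n}. inv \<sigma> i < i \<and> \<not> \<sigma> i < i} = {i \<in> {1..n}. inv \<sigma> i < i \<and> i < \<sigma> i}"
  proof (rule Collect_cong)
    fix i show "i \<in> {1..n} \<and> inv \<sigma> i < i \<and> \<not> \<sigma> i < i \<longleftrightarrow> i \<in> {1..n} \<and> inv \<sigma> i < i \<and> i < \<sigma> i"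
      using fix_iff[of i] by (auto simp: not_less le_less)
  qed
  finally show E: "exc n \<sigma> = cda n \<sigma> + cpk n \<sigma>"
    by (simp add: cda_def cpk_def)
  have "exc n \<sigma> = card {i \<in> {1..n}. i < \<sigma> i \<and> inv \<sigma> i < i} + card {i \<in> {1..n}. i < \<sigma> i \<and> \<not> inv \<sigma> i < i}"
    unfolding exc_def by (intro card_filter_split finite_atLeastAtMost)
  then show "card {i \<in> {1..n}. i < \<sigma> i \<and> \<not> inv \<sigma> i < i} = cpk n \<sigma>"
    using E by (simp add: cda_def conj_commute)
  have "drops n \<sigma> = card {i \<in> {1..n}. \<sigma> i < i \<and> inv \<sigma> i < i} + card {i \<in> {1..n}. \<sigma> i < i \<and> \<not> inv \<sigma> i < i}"
    unfolding drops_def by (intro card_filter_split finite_atLeastAtMost)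
  also have "{i \<in> {1..n}. \<sigma> i < i \<and> \<not> inv \<sigma> i < i} = {i \<in> {1..n}. inv \<sigma> i > i \<and> i > \<sigma> i}"
  proof (rule Collect_cong)
    fix i show "i \<in> {1..n} \<and> \<sigma> i < i \<and> \<not> inv \<sigma> i < i \<longleftrightarrow> i \<in> {1..n} \<and> inv \<sigma> i > i \<and> i > \<sigma> i"
      using fix_iff[of i] by (auto simp: not_less le_less)
  qed
  finally show "drops n \<sigma> = cdd n \<sigma> + cpk n \<sigma>"
    by (simp add: cdd_def cpk_def conj_commute)
qed

lemma cycle_prod_statistics:
  assumes \<sigma>: "\<sigma> \<in> perms n"
  shows "cycle_prod f b c w {1..n} \<sigma> = f ^ fixpts n \<sigma> * b ^ cda n \<sigma> * c ^ cdd n \<sigma> * w ^ cpk n \<sigma>"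
proof -
  have p: "\<sigma> permutes {1..n}" using \<sigma> by (simp add: perms_def)
  have fix_iff: "inv \<sigma> i = i \<longleftrightarrow> \<sigma> i = i" for i
    using permutes_inv_eq[OF p] by blast
  have "cycle_prod f b c w {1..n} \<sigma> = (\<Prod>i\<in>{1..n}. (if i = \<sigma> i then f else 1)
      * (if inv \<sigma> i < i \<and> i < \<sigma> i then b else 1) * (if inv \<sigma> i > i \<and> i > \<sigma> i then c else 1)
      * (if i < \<sigma> i \<and> \<not> inv \<sigma> i < i then w else 1))"
    unfolding cycle_prod_def
  proof (intro prod.cong refl)
    fix i
    show "cycle_factor f b c w (\<sigma> i = i) (inv \<sigma> i < i) (\<sigma> i < i) = (if i = \<sigma> i then f else 1)
      * (if inv \<sigma> i < i \<and> i < \<sigma> i then b else 1) * (if inv \<sigma> i > i \<and> i > \<sigma> i then c else 1)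
      * (if i < \<sigma> i \<and> \<not> inv \<sigma> i < i then w else 1)"
      using fix_iff[of i]
      by (cases "\<sigma> i" i rule: linorder_cases; cases "inv \<sigma> i" i rule: linorder_cases)
        (auto simp: cycle_factor_def)
  qed
  also have "\<dots> = f ^ fixpts n \<sigma> * b ^ cda n \<sigma> * c ^ cdd n \<sigma> * w ^ card {i \<in> {1..n}. i < \<sigma> i \<and> \<not> inv \<sigma> i < i}"
    by (simp only: prod.distrib prod_if_const finite_atLeastAtMost fixpts_def cda_def cdd_def)
  finally show ?thesis by (simp only: cycle_counts[OF \<sigma>])
qed

lemma fixpts_le_cyc: "fixpts n \<sigma> \<le> cyc n \<sigma>"
proof -
  have "(\<lambda>i. {i}) ` {i \<in> {1..n}. i = \<sigma> i} \<subseteq> orbit \<sigma> ` {1..n}"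
  proof (rule image_subsetI)
    fix i assume i: "i \<in> {i \<in> {1..n}. i = \<sigma> i}"
    then have "orbit \<sigma> i = {i}" by (simp add: orbit_eq_singleton_iff)
    with i show "{i} \<in> orbit \<sigma> ` {1..n}" by (metis (no_types, lifting) image_eqI mem_Collect_eq)
  qed
  then have "card ((\<lambda>i. {i}) ` {i \<in> {1..n}. i = \<sigma> i}) \<le> cyc n \<sigma>"
    unfolding cyc_def by (intro card_mono) auto
  then show ?thesis by (simp add: fixpts_def card_image)
qed

section \<open>The gamma expansion\<close>

text \<open>
Both sums are polynomial functions of \<open>w\<close>, and on an infinite field these determine their
coefficients.
\<close>

lemma coefficients_by_statistic:
  fixes g :: "nat \<Rightarrow> 'a::field_char_0"
  assumes "finite P" "j \<le> N"
    and eq: "\<And>w. (\<Sum>\<sigma>\<in>P. u \<sigma> * w ^ s \<sigma>) = (\<Sum>j = 0..N. g j * w ^ j)"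
  shows "g j = (\<Sum>\<sigma> | \<sigma> \<in> P \<and> s \<sigma> = j. u \<sigma>)"
proof -
  have "poly (\<Sum>\<sigma>\<in>P. monom (u \<sigma>) (s \<sigma>)) = poly (\<Sum>j = 0..N. monom (g j) j)"
    using eq by (simp add: fun_eq_iff poly_sum poly_monom)
  then have "coeff (\<Sum>\<sigma>\<in>P. monom (u \<sigma>) (s \<sigma>)) j = coeff (\<Sum>j = 0..N. monom (g j) j) j"
    by (simp only: poly_eq_poly_eq_iff)
  then show ?thesis
    using assms(1,2) by (simp add: coeff_sum sum.inter_filter)
qed

lemma word_sum_statistics:
  "word_sum a a' d d' w \<alpha> n = (\<Sum>\<sigma>\<in>perms (n + 1).
     \<alpha> ^ (lmax (n + 1) \<sigma> + rmax (n + 1) \<sigma> - 2) *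
     (a ^ lmaxda (n + 1) \<sigma> * a' ^ (da (n + 1) \<sigma> - lmaxda (n + 1) \<sigma>) * d ^ rmaxdd (n + 1) \<sigma>
        * d' ^ (dd (n + 1) \<sigma> - rmaxdd (n + 1) \<sigma>) * w ^ valleys (n + 1) \<sigma>))"
  by (simp add: word_sum_def word_prod_statistics)

lemma cycle_sum_statistics:
  "cycle_sum f b c w \<beta> {1..n} = (\<Sum>\<sigma>\<in>perms n. \<beta> ^ cyc n \<sigma> *
     (f ^ fixpts n \<sigma> * b ^ cda n \<sigma> * c ^ cdd n \<sigma> * w ^ cpk n \<sigma>))"
  unfolding cycle_sum_def perms_def[symmetric] cyc_def
  by (intro sum.cong) (simp_all only: perms_def mem_Collect_eq cycle_prod_statistics)

text \<open>
Setting the weights of double ascents to zero leaves the words counted by \<open>gamma_coeff n j\<close>, which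
have \<open>j\<close> valleys and \<open>n - 2 * j\<close> double descents.
\<close>

lemma word_sum_without_double_ascents:
  "word_sum 0 0 (t * T) T w \<alpha> n = (\<Sum>j = 0..n div 2. gamma_coeff n j \<alpha> t * w ^ j * T ^ (n - 2 * j))"
proof -
  let ?m = "n + 1"
  let ?P = "{\<sigma> \<in> perms ?m. da ?m \<sigma> = 0}"
  let ?u = "\<lambda>\<sigma>. \<alpha> ^ (lmax ?m \<sigma> + rmax ?m \<sigma> - 2) * t ^ rmaxdd ?m \<sigma>"
  have "word_sum 0 0 (t * T) T w \<alpha> n =
      (\<Sum>\<sigma>\<in>perms ?m. if da ?m \<sigma> = 0 then ?u \<sigma> * w ^ asc ?m \<sigma> * T ^ (n - 2 * asc ?m \<sigma>) else 0)"
    unfolding word_sum_statistics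
  proof (intro sum.cong refl)
    fix \<sigma> assume \<sigma>: "\<sigma> \<in> perms ?m"
    show "\<alpha> ^ (lmax ?m \<sigma> + rmax ?m \<sigma> - 2) * (0 ^ lmaxda ?m \<sigma> * 0 ^ (da ?m \<sigma> - lmaxda ?m \<sigma>)
        * (t * T) ^ rmaxdd ?m \<sigma> * T ^ (dd ?m \<sigma> - rmaxdd ?m \<sigma>) * w ^ valleys ?m \<sigma>)
      = (if da ?m \<sigma> = 0 then ?u \<sigma> * w ^ asc ?m \<sigma> * T ^ (n - 2 * asc ?m \<sigma>) else 0)"
    proof (cases "da ?m \<sigma> = 0")
      case True
      have "n - 2 * asc ?m \<sigma> = rmaxdd ?m \<sigma> + (dd ?m \<sigma> - rmaxdd ?m \<sigma>)"
        using word_counts[of \<sigma> n] \<sigma> True rmaxdd_le_dd[of ?m \<sigma>] by simp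
      then show ?thesis
        using True lmaxda_le_da[of ?m \<sigma>] word_counts(1)[of \<sigma> n] \<sigma>
        by (simp add: power_mult_distrib power_add algebra_simps)
    next
      case False
      then show ?thesis using lmaxda_le_da[of ?m \<sigma>] by (auto simp: power_0_left)
    qed
  qed
  also have "\<dots> = (\<Sum>\<sigma>\<in>?P. ?u \<sigma> * w ^ asc ?m \<sigma> * T ^ (n - 2 * asc ?m \<sigma>))"
    by (rule sum.inter_filter[symmetric]) (rule finite_perms)
  also have "\<dots> = (\<Sum>j = 0..n div 2. \<Sum>\<sigma> | \<sigma> \<in> ?P \<and> asc ?m \<sigma> = j. ?u \<sigma> * w ^ asc ?m \<sigma> * T ^ (n - 2 * asc ?m \<sigma>))"
  proof (rule sum.group[symmetric])
    show "asc ?m ` ?P \<subseteq> {0..n div 2}"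
    proof (rule image_subsetI)
      fix \<sigma> assume "\<sigma> \<in> ?P"
      then show "asc ?m \<sigma> \<in> {0..n div 2}" using word_counts[of \<sigma> n] by simp
    qed
  qed (simp_all add: finite_perms)
  also have "\<dots> = (\<Sum>j = 0..n div 2. gamma_coeff n j \<alpha> t * w ^ j * T ^ (n - 2 * j))"
    by (intro sum.cong refl) (simp add: gamma_coeff_def sum_distrib_right conj_assoc)
  finally show ?thesis .
qed

lemma Eulerian_at_eq_word_sum:
  "Eulerian_at n x y t \<alpha> = word_sum (t * x) x (t * y) y (x * y) \<alpha> n"
  unfolding Eulerian_at_def word_sum_statistics
proof (intro sum.cong refl)
  fix \<sigma> assume \<sigma>: "\<sigma> \<in> perms (n + 1)"
  let ?m = "n + 1"
  have "asc ?m \<sigma> = lmaxda ?m \<sigma> + (da ?m \<sigma> - lmaxda ?m \<sigma>) + valleys ?m \<sigma>"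
    "des ?m \<sigma> = rmaxdd ?m \<sigma> + (dd ?m \<sigma> - rmaxdd ?m \<sigma>) + valleys ?m \<sigma>"
    using word_counts[of \<sigma> n] \<sigma> lmaxda_le_da[of ?m \<sigma>] rmaxdd_le_dd[of ?m \<sigma>] by simp_all
  then show "x ^ asc ?m \<sigma> * y ^ des ?m \<sigma> * t ^ (lmaxda ?m \<sigma> + rmaxdd ?m \<sigma>)
      * \<alpha> ^ (lmax ?m \<sigma> + rmax ?m \<sigma> - 2) =
    \<alpha> ^ (lmax ?m \<sigma> + rmax ?m \<sigma> - 2) *
     ((t * x) ^ lmaxda ?m \<sigma> * x ^ (da ?m \<sigma> - lmaxda ?m \<sigma>) * (t * y) ^ rmaxdd ?m \<sigma>
        * y ^ (dd ?m \<sigma> - rmaxdd ?m \<sigma>) * (x * y) ^ valleys ?m \<sigma>)"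
    by (simp only: power_add power_mult_distrib) (simp add: ac_simps)
qed

lemma gamma_generating:
  fixes \<alpha> t w :: "'a::field_char_0"
  shows "(\<Sum>j = 0..n div 2. gamma_coeff n j \<alpha> t * w ^ j) = word_sum 0 0 t 1 w \<alpha> n"
  using word_sum_without_double_ascents[of t 1 w \<alpha> n] by simp

text \<open>
Splitting the weight \<open>2 = 1 + 1\<close> of double descents evenly between double ascents and double
descents removes the restriction on the words, at the price of the factor \<open>2 ^ (n - 2 * j)\<close>.
\<close>

lemma gamma_scaled_generating:
  fixes \<alpha> t w :: "'a::field_char_0"
  shows "(\<Sum>j = 0..n div 2. 2 ^ (n - 2 * j) * gamma_coeff n j \<alpha> t * w ^ j) = word_sum t 1 t 1 w \<alpha> n"
proof -
  have "word_sum t 1 t 1 w \<alpha> n = word_sum 0 0 (t * 2) 2 w \<alpha> n"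
    by (rule word_sum_cong) simp_all
  then show ?thesis
    by (simp add: word_sum_without_double_ascents ac_simps)
qed

text \<open>
The pair of \<open>\<beta> = 2 * \<alpha>\<close> per cycle and \<open>f = t / 2\<close> per fixed point leaves a factor \<open>2\<close> for each
cycle that is not a fixed point.
\<close>

lemma gamma_cycle_no_cda:
  fixes \<alpha> t :: "'a::field_char_0"
  assumes "j \<le> n div 2"
  shows "gamma_coeff n j \<alpha> t = (\<Sum>\<sigma> | \<sigma> \<in> perms n \<and> cda n \<sigma> = 0 \<and> exc n \<sigma> = j.
      2 ^ (cyc n \<sigma> - fixpts n \<sigma>) * \<alpha> ^ cyc n \<sigma> * t ^ fixpts n \<sigma>)"
proof -
  let ?P = "{\<sigma> \<in> perms n. cda n \<sigma> = 0}"
  let ?u = "\<lambda>\<sigma>. 2 ^ (cyc n \<sigma> - fixpts n \<sigma>) * \<alpha> ^ cyc n \<sigma> * t ^ fixpts n \<sigma>"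
  have "(\<Sum>\<sigma>\<in>?P. ?u \<sigma> * w ^ exc n \<sigma>) = (\<Sum>j = 0..n div 2. gamma_coeff n j \<alpha> t * w ^ j)" for w
  proof -
    have "(\<Sum>\<sigma>\<in>?P. ?u \<sigma> * w ^ exc n \<sigma>) = (\<Sum>\<sigma>\<in>perms n. if cda n \<sigma> = 0 then ?u \<sigma> * w ^ exc n \<sigma> else 0)"
      by (rule sum.inter_filter) (rule finite_perms)
    also have "\<dots> = cycle_sum (t / 2) 0 1 w (2 * \<alpha>) {1..n}"
      unfolding cycle_sum_statistics
      by (intro sum.cong refl)
        (simp add: cycle_counts power_0_left fixpts_le_cyc power_diff power_mult_distrib power_divide field_simps)
    also have "\<dots> = word_sum 0 0 t 1 w \<alpha> n"
      using word_sum_eq_cycle_sum[of 0 t "t / 2" 0 1 0 1 "{1..n}" w \<alpha>] by simp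
    finally show ?thesis by (simp only: gamma_generating)
  qed
  from coefficients_by_statistic[OF _ assms this] show ?thesis
    by (simp add: finite_perms conj_assoc)
qed

lemma gamma_cycle_no_cdd:
  fixes \<alpha> t :: "'a::field_char_0"
  assumes "j \<le> n div 2"
  shows "gamma_coeff n j \<alpha> t = (\<Sum>\<sigma> | \<sigma> \<in> perms n \<and> cdd n \<sigma> = 0 \<and> drops n \<sigma> = j.
      2 ^ (cyc n \<sigma> - fixpts n \<sigma>) * \<alpha> ^ cyc n \<sigma> * t ^ fixpts n \<sigma>)"
proof -
  let ?P = "{\<sigma> \<in> perms n. cdd n \<sigma> = 0}"
  let ?u = "\<lambda>\<sigma>. 2 ^ (cyc n \<sigma> - fixpts n \<sigma>) * \<alpha> ^ cyc n \<sigma> * t ^ fixpts n \<sigma>"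
  have "(\<Sum>\<sigma>\<in>?P. ?u \<sigma> * w ^ drops n \<sigma>) = (\<Sum>j = 0..n div 2. gamma_coeff n j \<alpha> t * w ^ j)" for w
  proof -
    have "(\<Sum>\<sigma>\<in>?P. ?u \<sigma> * w ^ drops n \<sigma>) = (\<Sum>\<sigma>\<in>perms n. if cdd n \<sigma> = 0 then ?u \<sigma> * w ^ drops n \<sigma> else 0)"
      by (rule sum.inter_filter) (rule finite_perms)
    also have "\<dots> = cycle_sum (t / 2) 1 0 w (2 * \<alpha>) {1..n}"
      unfolding cycle_sum_statistics
      by (intro sum.cong refl)
        (simp add: cycle_counts power_0_left fixpts_le_cyc power_diff power_mult_distrib power_divide field_simps)
    also have "\<dots> = word_sum 0 0 t 1 w \<alpha> n"
      using word_sum_eq_cycle_sum[of 0 t "t / 2" 0 1 1 0 "{1..n}" w \<alpha>] by simp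
    finally show ?thesis by (simp only: gamma_generating)
  qed
  from coefficients_by_statistic[OF _ assms this] show ?thesis
    by (simp add: finite_perms conj_assoc)
qed

lemma gamma_word_no_dd:
  fixes \<alpha> t :: "'a::field_char_0"
  assumes "j \<le> n div 2"
  shows "gamma_coeff n j \<alpha> t = (\<Sum>\<sigma> | \<sigma> \<in> perms (n + 1) \<and> dd (n + 1) \<sigma> = 0 \<and> des (n + 1) \<sigma> = j.
      \<alpha> ^ (lmax (n + 1) \<sigma> + rmax (n + 1) \<sigma> - 2) * t ^ lmaxda (n + 1) \<sigma>)"
proof -
  let ?m = "n + 1"
  let ?P = "{\<sigma> \<in> perms ?m. dd ?m \<sigma> = 0}"
  let ?u = "\<lambda>\<sigma>. \<alpha> ^ (lmax ?m \<sigma> + rmax ?m \<sigma> - 2) * t ^ lmaxda ?m \<sigma>"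
  have "(\<Sum>\<sigma>\<in>?P. ?u \<sigma> * w ^ des ?m \<sigma>) = (\<Sum>j = 0..n div 2. gamma_coeff n j \<alpha> t * w ^ j)" for w
  proof -
    have "(\<Sum>\<sigma>\<in>?P. ?u \<sigma> * w ^ des ?m \<sigma>) = (\<Sum>\<sigma>\<in>perms ?m. if dd ?m \<sigma> = 0 then ?u \<sigma> * w ^ des ?m \<sigma> else 0)"
      by (rule sum.inter_filter) (rule finite_perms)
    also have "\<dots> = word_sum t 1 0 0 w \<alpha> n"
      unfolding word_sum_statistics
    proof (intro sum.cong refl)
      fix \<sigma> assume "\<sigma> \<in> perms ?m"
      then show "(if dd ?m \<sigma> = 0 then ?u \<sigma> * w ^ des ?m \<sigma> else 0) =
          \<alpha> ^ (lmax ?m \<sigma> + rmax ?m \<sigma> - 2) * (t ^ lmaxda ?m \<sigma> * 1 ^ (da ?m \<sigma> - lmaxda ?m \<sigma>)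
            * 0 ^ rmaxdd ?m \<sigma> * 0 ^ (dd ?m \<sigma> - rmaxdd ?m \<sigma>) * w ^ valleys ?m \<sigma>)"
        using word_counts(2)[of \<sigma> n] rmaxdd_le_dd[of ?m \<sigma>] by (auto simp: power_0_left)
    qed
    also have "\<dots> = word_sum 0 0 t 1 w \<alpha> n"
      by (rule word_sum_cong) simp_all
    finally show ?thesis by (simp only: gamma_generating)
  qed
  from coefficients_by_statistic[OF _ assms this] show ?thesis
    by (simp add: finite_perms conj_assoc)
qed

lemma eq_two_powi_mult:
  fixes x y :: "'a::field_char_0"
  assumes "2 * j \<le> n" "2 ^ (n - 2 * j) * x = y"
  shows "x = 2 powi (2 * int j - int n) * y"
proof -
  have "2 * int j - int n = - int (n - 2 * j)" using assms(1) by simp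
  then have "(2::'a) powi (2 * int j - int n) = inverse (2 ^ (n - 2 * j))"
    by (simp only: power_int_minus power_int_of_nat)
  then show ?thesis using assms(2) by (auto simp: field_simps)
qed

lemma gamma_word_peaks:
  fixes \<alpha> t :: "'a::field_char_0"
  assumes "j \<le> n div 2"
  shows "gamma_coeff n j \<alpha> t = 2 powi (2 * int j - int n) *
    (\<Sum>\<sigma> | \<sigma> \<in> perms (n + 1) \<and> pk (n + 1) \<sigma> = j + 1.
      \<alpha> ^ (lmax (n + 1) \<sigma> + rmax (n + 1) \<sigma> - 2) * t ^ (lmaxda (n + 1) \<sigma> + rmaxdd (n + 1) \<sigma>))"
proof -
  let ?m = "n + 1"
  let ?u = "\<lambda>\<sigma>. \<alpha> ^ (lmax ?m \<sigma> + rmax ?m \<sigma> - 2) * t ^ (lmaxda ?m \<sigma> + rmaxdd ?m \<sigma>)"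
  have "(\<Sum>\<sigma>\<in>perms ?m. ?u \<sigma> * w ^ valleys ?m \<sigma>) =
      (\<Sum>j = 0..n div 2. 2 ^ (n - 2 * j) * gamma_coeff n j \<alpha> t * w ^ j)" for w
    unfolding gamma_scaled_generating word_sum_statistics by (simp add: power_add ac_simps)
  from coefficients_by_statistic[OF finite_perms assms this]
  have "2 ^ (n - 2 * j) * gamma_coeff n j \<alpha> t = (\<Sum>\<sigma> | \<sigma> \<in> perms ?m \<and> valleys ?m \<sigma> = j. ?u \<sigma>)" .
  moreover have "{\<sigma>. \<sigma> \<in> perms ?m \<and> valleys ?m \<sigma> = j} = {\<sigma>. \<sigma> \<in> perms ?m \<and> pk ?m \<sigma> = j + 1}"
    using word_counts(4)[of _ n] by auto
  ultimately show ?thesis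
    using assms by (intro eq_two_powi_mult) simp_all
qed

lemma gamma_cycle_peaks:
  fixes \<alpha> t :: "'a::field_char_0"
  assumes "j \<le> n div 2"
  shows "gamma_coeff n j \<alpha> t = 2 powi (2 * int j - int n) *
    (\<Sum>\<sigma> | \<sigma> \<in> perms n \<and> cpk n \<sigma> = j. (2 * \<alpha>) ^ cyc n \<sigma> * t ^ fixpts n \<sigma>)"
proof -
  have "(\<Sum>\<sigma>\<in>perms n. ((2 * \<alpha>) ^ cyc n \<sigma> * t ^ fixpts n \<sigma>) * w ^ cpk n \<sigma>) =
      (\<Sum>j = 0..n div 2. 2 ^ (n - 2 * j) * gamma_coeff n j \<alpha> t * w ^ j)" for w
  proof -
    have "(\<Sum>\<sigma>\<in>perms n. ((2 * \<alpha>) ^ cyc n \<sigma> * t ^ fixpts n \<sigma>) * w ^ cpk n \<sigma>)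
        = cycle_sum t 1 1 w (2 * \<alpha>) {1..n}"
      unfolding cycle_sum_statistics by (simp add: mult.assoc)
    also have "\<dots> = word_sum t 1 t 1 w \<alpha> n"
      using word_sum_eq_cycle_sum[of t t t 1 1 1 1 "{1..n}" w \<alpha>] by simp
    finally show ?thesis by (simp only: gamma_scaled_generating)
  qed
  from coefficients_by_statistic[OF finite_perms assms this] show ?thesis
    using assms by (intro eq_two_powi_mult) simp_all
qed

theorem theorem2p6:
  fixes n :: nat and x y t \<alpha> :: "'a::field_char_0"
  shows "Eulerian_at n x y t \<alpha> =
           (\<Sum>j = 0..n div 2. gamma_coeff n j \<alpha> t * (x * y) ^ j * (x + y) ^ (n - 2 * j))
       \<and> (\<forall>j \<le> n div 2.
           gamma_coeff n j \<alpha> t =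
             (\<Sum>\<sigma> | \<sigma> \<in> perms (n + 1) \<and> da (n + 1) \<sigma> = 0 \<and> asc (n + 1) \<sigma> = j.
                \<alpha> ^ (lmax (n + 1) \<sigma> + rmax (n + 1) \<sigma> - 2) * t ^ rmaxdd (n + 1) \<sigma>)
         \<and> gamma_coeff n j \<alpha> t =
             (\<Sum>\<sigma> | \<sigma> \<in> perms n \<and> cda n \<sigma> = 0 \<and> exc n \<sigma> = j.
                2 ^ (cyc n \<sigma> - fixpts n \<sigma>) * \<alpha> ^ cyc n \<sigma> * t ^ fixpts n \<sigma>)
         \<and> gamma_coeff n j \<alpha> t =
             (\<Sum>\<sigma> | \<sigma> \<in> perms (n + 1) \<and> dd (n + 1) \<sigma> = 0 \<and> des (n + 1) \<sigma> = j.
                \<alpha> ^ (lmax (n + 1) \<sigma> + rmax (n + 1) \<sigma> - 2) * t ^ lmaxda (n + 1) \<sigma>)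
         \<and> gamma_coeff n j \<alpha> t =
             (\<Sum>\<sigma> | \<sigma> \<in> perms n \<and> cdd n \<sigma> = 0 \<and> drops n \<sigma> = j.
                2 ^ (cyc n \<sigma> - fixpts n \<sigma>) * \<alpha> ^ cyc n \<sigma> * t ^ fixpts n \<sigma>)
         \<and> gamma_coeff n j \<alpha> t =
             2 powi (2 * int j - int n) *
             (\<Sum>\<sigma> | \<sigma> \<in> perms (n + 1) \<and> pk (n + 1) \<sigma> = j + 1.
                \<alpha> ^ (lmax (n + 1) \<sigma> + rmax (n + 1) \<sigma> - 2)
                * t ^ (lmaxda (n + 1) \<sigma> + rmaxdd (n + 1) \<sigma>))
         \<and> gamma_coeff n j \<alpha> t =
             2 powi (2 * int j - int n) *
             (\<Sum>\<sigma> | \<sigma> \<in> perms n \<and> cpk n \<sigma> = j.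
                (2 * \<alpha>) ^ cyc n \<sigma> * t ^ fixpts n \<sigma>))"
proof (rule conjI)
  have "Eulerian_at n x y t \<alpha> = word_sum 0 0 (t * (x + y)) (x + y) (x * y) \<alpha> n"
    unfolding Eulerian_at_eq_word_sum by (rule word_sum_cong) (simp_all add: algebra_simps)
  then show "Eulerian_at n x y t \<alpha> =
      (\<Sum>j = 0..n div 2. gamma_coeff n j \<alpha> t * (x * y) ^ j * (x + y) ^ (n - 2 * j))"
    by (simp only: word_sum_without_double_ascents)
qed (intro allI impI conjI; rule gamma_coeff_def gamma_cycle_no_cda gamma_word_no_dd gamma_cycle_no_cdd
      gamma_word_peaks gamma_cycle_peaks; assumption)

end
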